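(* Let $A\subset\mathbb{C}^n$ be a non-empty finite set and let $\mathcal{E}^{\mathbb{C}}(z)=\sum_{a\in A}\xi_ae^{(a,z)}$, $z\in\mathbb{C}^n$, with $\xi_a$ i.i.d. standard complex Gaussian variables. Then for every open set $U\subset\mathbb{C}^n$, $$\mathbb{E}\mathbb{S}\{\mathcal{E}^{\mathbb{C}};U\}=\frac{n!}{\pi^n}\int_U\det\big(\partial_z\bar\partial_z\Phi^{\mathbb{C}}\big)\,dz,$$ where $\Phi^{\mathbb{C}}(z):=\log\Big(\sum_{a\in A}e^{2\mathrm{Re}(a,z)}\Big)$.
   Context: $(\cdot,\cdot)$ is the standard Hermitian form on $\mathbb{C}^n$, taken complex linear in the second argument: $(a,z)=\sum_j\overline{a_j}z_j$, so that $\mathcal{E}^{\mathbb{C}}$ is holomorphic. A standard complex Gaussian variable is $\xi=\frac1{\sqrt2}(\xi^R+i\xi^I)$ with $\xi^R,\xi^I$ independent standard real Gaussians. $\mathbb{E}\mathbb{S}\{\mathcal{E}^{\mathbb{C}};U\}$ is the expected number of $z\in U$ with $\mathcal{E}_1(z)=\dots=\mathcal{E}_n(z)=0$, where $\mathcal{E}_1,\dots,\mathcal{E}_n$ are i.i.d. copies of $\mathcal{E}^{\mathbb{C}}$. $\partial_z\bar\partial_z\Phi$ is the complex Hessian, i.e. the $n\times n$ matrix $\big(\frac{\partial^2\Phi}{\partial z_j\partial\bar z_k}\big)_{j,k}$, and $dz$ is Lebesgue measure on $\mathbb{C}^n\cong\mathbb{R}^{2n}$. *)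

theory Defs
  imports "HOL-Probability.Probability"
begin

definition herm :: "complex ^ 'n \<Rightarrow> complex ^ 'n \<Rightarrow> complex" where
  "herm a z = (\<Sum>j\<in>UNIV. cnj (a $ j) * z $ j)"

definition exp_sum :: "(complex ^ 'n) set \<Rightarrow> (complex ^ 'n \<Rightarrow> complex) \<Rightarrow> complex ^ 'n \<Rightarrow> complex" where
  "exp_sum A c z = (\<Sum>a\<in>A. c a * exp (herm a z))"

definition std_complex_gaussian :: "'w measure \<Rightarrow> ('w \<Rightarrow> complex) \<Rightarrow> bool" where
  "std_complex_gaussian M X \<longleftrightarrow>
     (\<exists>X\<^sub>R X\<^sub>I :: 'w \<Rightarrow> real.
        distributed M lborel X\<^sub>R (\<lambda>x. ennreal (std_normal_density x)) \<and>
        distributed M lborel X\<^sub>I (\<lambda>x. ennreal (std_normal_density x)) \<and>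
        prob_space.indep_var M borel X\<^sub>R borel X\<^sub>I \<and>
        (\<forall>\<omega>\<in>space M. X \<omega> =
           (1 / complex_of_real (sqrt 2)) * (complex_of_real (X\<^sub>R \<omega>) + \<i> * complex_of_real (X\<^sub>I \<omega>))))"

text \<open>
  The zeros are counted with values in \<open>[0, \<infinity>]\<close>: a realisation with infinitely many zeros
  in \<open>U\<close> contributes \<open>\<infinity>\<close> (with \<^const>\<open>card\<close> it would contribute 0).
\<close>
definition expected_zeros ::
    "'w measure \<Rightarrow> ('n \<Rightarrow> 'w \<Rightarrow> complex ^ 'n \<Rightarrow> complex) \<Rightarrow> (complex ^ 'n) set \<Rightarrow> ennreal" where
  "expected_zeros M E U =
     (\<integral>\<^sup>+ \<omega>. emeasure (count_space UNIV) {z \<in> U. \<forall>k. E k \<omega> z = 0} \<partial>M)"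

definition dir_deriv :: "complex ^ 'n \<Rightarrow> (complex ^ 'n \<Rightarrow> complex) \<Rightarrow> complex ^ 'n \<Rightarrow> complex" where
  "dir_deriv v f z = vector_derivative (\<lambda>t::real. f (z + t *\<^sub>R v)) (at 0)"

text \<open>
  Wirtinger derivatives: with \<open>z\<^sub>j = x\<^sub>j + \<i> y\<^sub>j\<close>, the partial derivatives in \<open>x\<^sub>j\<close> and \<open>y\<^sub>j\<close> are
  the derivatives along \<open>axis j 1\<close> and \<open>axis j \<i>\<close>.
\<close>
definition wirtinger :: "'n \<Rightarrow> (complex ^ 'n \<Rightarrow> complex) \<Rightarrow> complex ^ 'n \<Rightarrow> complex" where
  "wirtinger j f z = (dir_deriv (axis j 1) f z - \<i> * dir_deriv (axis j \<i>) f z) / 2"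

definition wirtinger_bar :: "'n \<Rightarrow> (complex ^ 'n \<Rightarrow> complex) \<Rightarrow> complex ^ 'n \<Rightarrow> complex" where
  "wirtinger_bar j f z = (dir_deriv (axis j 1) f z + \<i> * dir_deriv (axis j \<i>) f z) / 2"

text \<open>
  For plurisubharmonic \<open>f\<close>, such as \<open>Phi A\<close> below, this matrix is Hermitian positive semidefinite, so
  its determinant is a non-negative real, and \<open>ennreal (Re (det _))\<close> loses nothing.
\<close>
definition complex_hessian :: "(complex ^ 'n \<Rightarrow> real) \<Rightarrow> complex ^ 'n \<Rightarrow> complex ^ 'n ^ 'n" where
  "complex_hessian f z =
     (\<chi> j k. wirtinger j (wirtinger_bar k (\<lambda>w. complex_of_real (f w))) z)"

definition Phi :: "(complex ^ 'n) set \<Rightarrow> complex ^ 'n \<Rightarrow> real" where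
  "Phi A z = ln (\<Sum>a\<in>A. exp (2 * Re (herm a z)))"

end

theory Submission
  imports Defs
begin

text \<open>
  Fix \<open>a0 \<in> A\<close>. Dividing the \<open>k\<close>-th equation by \<open>exp (a0, z)\<close> and solving it for the coefficient of
  \<open>a0\<close> turns the system into \<open>g z = \<zeta>\<close>, where \<open>\<zeta>\<close> is a standard Gaussian vector independent of the
  remaining coefficients \<open>\<eta>\<close> and \<open>g\<close> is a holomorphic map that depends on \<open>\<eta>\<close> only. Conditionally
  on \<open>\<eta>\<close>, the area formula (Sard's theorem discards the critical values) turns the expected number
  of solutions into the integral over \<open>U\<close> of \<open>\<phi> (g z) \<bar>det g' z\<bar>\<^sup>2\<close>, where \<open>\<phi>\<close> is the density of \<open>\<zeta>\<close>
  and \<open>\<bar>det g' z\<bar>\<^sup>2\<close> the real Jacobian. By Tonelli it remains to average this integrand over \<open>\<eta>\<close> for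
  fixed \<open>z\<close>. The rows of \<open>g' z\<close> are independent and identically distributed, also after weighting
  with the factors of \<open>\<phi> (g z)\<close>, so expanding the determinants gives \<open>n! / \<pi>\<^sup>n\<close> times the determinant of
  the matrix of weighted second moments of a row. This matrix is the covariance matrix of \<open>a\<close>
  under the Gibbs weights \<open>exp (2 Re (a, z)) / (\<Sum>b\<in>A. exp (2 Re (b, z)))\<close>, that is, the complex
  Hessian of \<open>Phi A\<close>.
\<close>

subsection \<open>The area formula\<close>

text \<open>The coefficient of \<open>a0\<close> is singled out because after the division it stands
  alone: the right-hand side \<zeta> has a density that depends neither on z nor on \<eta>, so the
  joint law of values and derivatives of the random functions never enters. The choice of
  \<open>a0\<close> leaves no trace in the result, since it only translates the frequencies and a
  covariance is translation invariant. The constant has two sources. The factor 1 / \<pi>^n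
  normalises the density of \<zeta>; n! counts permutations, because the averaged terms of the
  double expansion of det times its conjugate depend only on one permutation relative to the other.
  The Gaussian weight on a row adds a rank-one term to its precision matrix. The new determinant is
  the Gibbs denominator divided by exp (2 Re (a0, z)), and the rank-one correction of the inverse is
  what subtracts the product of the means in the covariance. Measurability is the obstacle on the
  way: the number of zeros must be a measurable function of the coefficients before independence can
  be exploited.\<close>

lemma change_of_variables_nn_integral:
  fixes g :: "real^'m::{finite,wellorder} \<Rightarrow> real^'m::_" and \<phi> :: "real^'m::_ \<Rightarrow> real"
  assumes S: "S \<in> sets lebesgue"
    and der: "\<And>x. x \<in> S \<Longrightarrow> (g has_derivative g' x) (at x)"
    and inj: "inj_on g S"
    and nonneg: "\<And>y. 0 \<le> \<phi> y" and int: "integrable lborel \<phi>"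
  shows "g ` S \<in> sets lebesgue"
    and "(\<lambda>x. ennreal (\<phi> (g x) * \<bar>det (matrix (g' x))\<bar>) * indicator S x) \<in> borel_measurable lebesgue"
    and "(\<integral>\<^sup>+y. ennreal (\<phi> y) * indicator (g ` S) y \<partial>lebesgue) =
         (\<integral>\<^sup>+x. ennreal (\<phi> (g x) * \<bar>det (matrix (g' x))\<bar>) * indicator S x \<partial>lebesgue)"
proof -
  have derS: "(g has_derivative g' x) (at x within S)" if "x \<in> S" for x
    using der[OF that] by (rule has_derivative_at_withinI)
  show gS: "g ` S \<in> sets lebesgue"
    using S derS by (intro differentiable_image_in_sets_lebesgue)
      (auto simp: differentiable_on_def differentiable_def)
  let ?D = "\<lambda>x. \<bar>det (matrix (g' x))\<bar> * \<phi> (g x)"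
  have "\<phi> absolutely_integrable_on UNIV"
    using int by (simp add: integrable_completion set_integrable_def)
  then have \<phi>S: "\<phi> absolutely_integrable_on g ` S"
    using gS by (rule set_integrable_subset) auto
  \<comment> \<open>The change of variables theorem is about vector-valued integrands, so \<phi> is
    passed through \<open>vec\<close> as a map into \<open>real^1\<close>.\<close>
  have eq: "?D absolutely_integrable_on S \<and> integral S ?D = integral (g ` S) \<phi>"
    using has_absolute_integral_change_of_variables [OF S derS inj,
        of "\<lambda>x. vec (\<phi> x) :: real^1" "vec (integral (g ` S) \<phi>)"] \<phi>S
    by (simp add: absolutely_integrable_on_1_iff integral_on_1_eq vec_eq_iff)
  have "(\<phi> has_integral integral (g ` S) \<phi>) (g ` S)"
    using \<phi>S absolutely_integrable_on_def by blast
  from nn_integral_has_integral_lebesgue'[OF nonneg this]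
  have 1: "(\<integral>\<^sup>+y. ennreal (\<phi> y) * indicator (g ` S) y \<partial>lebesgue) = ennreal (integral (g ` S) \<phi>)"
    by (simp add: nn_integral_completion)
  have "(?D has_integral integral (g ` S) \<phi>) S"
    using eq absolutely_integrable_on_def by (metis has_integral_integral)
  from nn_integral_has_integral_lebesgue'[OF _ this] nonneg
  have 2: "(\<integral>\<^sup>+x. ennreal (?D x) * indicator S x \<partial>lebesgue) = ennreal (integral (g ` S) \<phi>)"
    by (simp add: nn_integral_completion)
  show "(\<integral>\<^sup>+y. ennreal (\<phi> y) * indicator (g ` S) y \<partial>lebesgue) =
         (\<integral>\<^sup>+x. ennreal (\<phi> (g x) * \<bar>det (matrix (g' x))\<bar>) * indicator S x \<partial>lebesgue)"
    using 1 2 by (simp add: mult.commute)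
  have "(\<lambda>x. indicator S x * ?D x) \<in> borel_measurable lebesgue"
    using eq by (auto simp: set_integrable_def dest: borel_measurable_integrable)
  then have "(\<lambda>x. ennreal (indicator S x * ?D x)) \<in> borel_measurable lebesgue"
    by simp
  moreover have "ennreal (indicator S x * ?D x) = ennreal (\<phi> (g x) * \<bar>det (matrix (g' x))\<bar>) * indicator S x" for x
    by (simp add: indicator_def mult.commute)
  ultimately show "(\<lambda>x. ennreal (\<phi> (g x) * \<bar>det (matrix (g' x))\<bar>) * indicator S x) \<in> borel_measurable lebesgue"
    by simp
qed

text \<open>Injectivity bounds the contribution of each piece by 1, so counting solutions piece by
  piece leaves a series of indicators of images.\<close>

lemma count_fibre_eq_suminf:
  fixes S :: "nat \<Rightarrow> 'a set"
  assumes disj: "disjoint_family S" and inj: "\<And>i. inj_on g (S i)"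
  shows "emeasure (count_space UNIV) {x \<in> (\<Union>i. S i). g x = y} = (\<Sum>i. indicator (g ` S i) y :: ennreal)"
proof -
  have *: "emeasure (count_space UNIV) {x \<in> S i. g x = y} = indicator (g ` S i) y" for i
  proof (cases "y \<in> g ` S i")
    case True
    then obtain x where "x \<in> S i" "g x = y" by auto
    with inj[of i] have "{x \<in> S i. g x = y} = {x}" by (auto simp: inj_on_def)
    with True show ?thesis by simp
  next
    case False
    then have "{x \<in> S i. g x = y} = {}" by auto
    with False show ?thesis by (metis emeasure_empty indicator_simps(2))
  qed
  have "{x \<in> (\<Union>i. S i). g x = y} = (\<Union>i. {x \<in> S i. g x = y})" by auto
  moreover have "(\<Sum>i. emeasure (count_space UNIV) {x \<in> S i. g x = y}) =
      emeasure (count_space UNIV) (\<Union>i. {x \<in> S i. g x = y})"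
    using disj by (intro suminf_emeasure) (auto simp: disjoint_family_on_def)
  ultimately show ?thesis by (simp add: *)
qed

text \<open>An invertible derivative that varies continuously gives a ball of injectivity around
  every point of \<open>R\<close>, and the Lindelof property reduces these balls to countably
  many.\<close>

lemma locally_injective_cover:
  fixes g :: "real^'m::finite \<Rightarrow> real^'m::_"
  assumes R: "open R"
    and der: "\<And>x. x \<in> R \<Longrightarrow> (g has_derivative g' x) (at x)"
    and cont: "continuous_on R (\<lambda>x. matrix (g' x))"
    and nz: "\<And>x. x \<in> R \<Longrightarrow> det (matrix (g' x)) \<noteq> 0"
  obtains B :: "nat \<Rightarrow> (real^'m::_) set"
  where "\<And>i. open (B i)" "\<And>i. inj_on g (B i)" "(\<Union>i. B i) = R"
proof -
  have "\<exists>r>0. ball a r \<subseteq> R \<and> inj_on g (ball a r)" if a: "a \<in> R" for a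
  proof -
    have lin: "linear (g' x)" if "x \<in> R" for x
      using der[OF that] has_derivative_linear by blast
    have "invertible (matrix (g' a))" using nz[OF a] by (simp add: invertible_det_nz)
    then obtain N where N: "N ** matrix (g' a) = mat 1" by (auto simp: invertible_def)
    have ga: "g' x v = matrix (g' x) *v v" if "x \<in> R" for x v
      using lin[OF that] by (simp add: matrix_works)
    have id: "(*v) N \<circ> g' a = id"
      using ga[OF a] N by (auto simp: fun_eq_iff matrix_vector_mul_assoc)
    \<comment> \<open>Entrywise continuity of the derivative gives continuity in operator norm,
      because the norm is at most the sum of the absolute values of the entries.\<close>
    have on: "\<exists>d>0. \<forall>x. dist a x < d \<longrightarrow> onorm (\<lambda>v. g' x v - g' a v) < e" if "e > 0" for e
    proof -
      have "isCont (\<lambda>x. matrix (g' x)) a"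
        using cont R a by (simp add: continuous_on_eq_continuous_at)
      then have c: "isCont (\<lambda>x. \<Sum>i\<in>UNIV. \<Sum>j\<in>UNIV. \<bar>matrix (g' x) $ i $ j - matrix (g' a) $ i $ j\<bar>) a" (is "isCont ?s a")
        by (intro continuous_intros continuous_component)
      then have "eventually (\<lambda>x. ?s x < e) (at a)"
        using that unfolding isCont_def by (intro order_tendstoD(2)) auto
      then have "eventually (\<lambda>x. ?s x < e) (nhds a)"
        using that by (simp add: eventually_nhds_conv_at)
      moreover have "eventually (\<lambda>x. x \<in> R) (nhds a)"
        using R a eventually_nhds by blast
      ultimately have "eventually (\<lambda>x. ?s x < e \<and> x \<in> R) (nhds a)"
        by eventually_elim auto
      then obtain d where d: "d > 0" "\<And>x. dist x a < d \<Longrightarrow> ?s x < e \<and> x \<in> R"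
        by (auto simp: eventually_nhds_metric)
      have "onorm (\<lambda>v. g' x v - g' a v) < e" if "dist a x < d" for x
      proof -
        have x: "?s x < e" "x \<in> R" using d that by (auto simp: dist_commute)
        have "(\<lambda>v. g' x v - g' a v) = (*v) (matrix (g' x) - matrix (g' a))"
          using ga[OF x(2)] ga[OF a] by (auto simp: fun_eq_iff matrix_vector_mult_diff_rdistrib)
        moreover have "onorm ((*v) (matrix (g' x) - matrix (g' a))) \<le> ?s x"
          using onorm_le_matrix_component_sum[of "matrix (g' x) - matrix (g' a)"] by simp
        ultimately show ?thesis using x by simp
      qed
      then show ?thesis using d(1) by blast
    qed
    show ?thesis
      by (rule has_derivative_locally_injective[OF a R matrix_vector_mul_bounded_linear id der on])
         (auto simp: that)
  qed
  then obtain r where r: "\<And>a. a \<in> R \<Longrightarrow> r a > 0 \<and> ball a (r a) \<subseteq> R \<and> inj_on g (ball a (r a))"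
    by metis
  obtain F where F: "F \<subseteq> (\<lambda>a. ball a (r a)) ` R" "countable F" "\<Union>F = \<Union>((\<lambda>a. ball a (r a)) ` R)"
    using Lindelof[of "(\<lambda>a. ball a (r a)) ` R"] by auto
  have UR: "\<Union>F = R" using F(3) r by fastforce
  \<comment> \<open>Adding the empty set makes the family nonempty, so that it has an enumeration
    even when \<open>R\<close> is empty.\<close>
  define B where "B = from_nat_into (insert {} F)"
  have rB: "range B = insert {} F"
    unfolding B_def using F(2) by (intro range_from_nat_into) auto
  have "B i = {} \<or> (\<exists>a\<in>R. B i = ball a (r a))" for i
    using rB F(1) by (metis (no_types, lifting) image_iff insert_iff rangeI subset_eq)
  then have "open (B i)" "inj_on g (B i)" for i
    using r by (metis open_ball open_empty, metis inj_on_empty)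
  moreover have "(\<Union>i. B i) = R" using UR rB by simp
  ultimately show ?thesis by (rule that)
qed

text \<open>The critical points drop out of both sides for different reasons: on the right the
  Jacobian vanishes there, on the left their image is a null set. The regular points split into
  countably many disjoint pieces on which \<open>g\<close> is injective, and sums over pieces are
  exchanged with integrals in [0, \<infinity>].\<close>

theorem area_formula:
  fixes g :: "real^'m::{finite,wellorder} \<Rightarrow> real^'m::_" and \<phi> :: "real^'m::_ \<Rightarrow> real"
  assumes U: "open U"
    and der: "\<And>x. x \<in> U \<Longrightarrow> (g has_derivative g' x) (at x)"
    and cont: "continuous_on U (\<lambda>x. matrix (g' x))"
    and nonneg: "\<And>y. 0 \<le> \<phi> y" and int: "integrable lborel \<phi>"
  shows "(\<integral>\<^sup>+y. ennreal (\<phi> y) * emeasure (count_space UNIV) {x \<in> U. g x = y} \<partial>lborel) =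
         (\<integral>\<^sup>+x. ennreal (\<phi> (g x) * \<bar>det (matrix (g' x))\<bar>) * indicator U x \<partial>lborel)"
proof -
  let ?det = "\<lambda>x. det (matrix (g' x))"
  define R where "R = {x \<in> U. ?det x \<noteq> 0}"
  have cdet: "continuous_on U ?det"
    unfolding det_def by (intro continuous_intros continuous_on_component cont)
  have "open (U \<inter> ?det -` (- {0}))"
    using cdet U by (rule continuous_open_preimage) auto
  then have R: "open R" by (simp add: R_def Int_def vimage_def)
  have contR: "continuous_on R (\<lambda>x. matrix (g' x))"
    using cont by (rule continuous_on_subset) (auto simp: R_def)
  obtain B where B: "\<And>i. open (B i)" "\<And>i. inj_on g (B i)" "(\<Union>i::nat. B i) = R"
    by (rule locally_injective_cover[OF R _ contR, of g]) (auto simp: R_def der)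
  define S where "S = disjointed B"
  have SB: "S i \<subseteq> B i" for i by (simp add: S_def disjointed_subset)
  have US: "(\<Union>i. S i) = R" using B(3) by (simp add: S_def UN_disjointed_eq)
  have S: "S i \<in> sets lebesgue" for i
  proof -
    have "range S \<subseteq> sets borel"
      unfolding S_def using B(1) by (intro sets.range_disjointed_sets) auto
    then show ?thesis by (auto simp: range_subsetD)
  qed
  have injS: "inj_on g (S i)" for i using B(2) SB by (rule inj_on_subset)
  have derS: "(g has_derivative g' x) (at x)" if "x \<in> S i" for i x
    using that US by (intro der) (auto simp: R_def)
  have cv1 [measurable]: "g ` S i \<in> sets lebesgue" for i
    by (rule change_of_variables_nn_integral(1)[OF S derS injS nonneg int])
  have cv2 [measurable]: "(\<lambda>x. ennreal (\<phi> (g x) * \<bar>?det x\<bar>) * indicator (S i) x) \<in> borel_measurable lebesgue" for i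
    by (rule change_of_variables_nn_integral(2)[OF S derS injS nonneg int])
  have cv3: "(\<integral>\<^sup>+y. ennreal (\<phi> y) * indicator (g ` S i) y \<partial>lebesgue) =
      (\<integral>\<^sup>+x. ennreal (\<phi> (g x) * \<bar>?det x\<bar>) * indicator (S i) x \<partial>lebesgue)" for i
    by (rule change_of_variables_nn_integral(3)[OF S derS injS nonneg int])
  have "negligible (g ` (U - R))"
  proof (rule baby_Sard)
    fix x assume x: "x \<in> U - R"
    then show "(g has_derivative g' x) (at x within U - R)"
      using der by (auto intro: has_derivative_at_withinI)
    show "rank (matrix (g' x)) < CARD('m)"
      using x by (auto simp: R_def det_eq_0_rank)
  qed simp
  then have "g ` (U - R) \<in> null_sets lebesgue" by (simp add: negligible_iff_null_sets)
  then have ae: "AE y in lebesgue. y \<notin> g ` (U - R)" by (rule AE_not_in)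
  have [measurable]: "\<phi> \<in> borel_measurable lebesgue"
    using int by (intro measurable_completion) auto
  \<comment> \<open>The computation takes place over \<open>lebesgue\<close>, since the images of
    the pieces under \<open>g\<close> are known to be measurable only in the completion; the two
    outer integrals are the same over \<open>lborel\<close>.\<close>
  have "(\<integral>\<^sup>+y. ennreal (\<phi> y) * emeasure (count_space UNIV) {x \<in> U. g x = y} \<partial>lebesgue) =
      (\<integral>\<^sup>+y. (\<Sum>i. ennreal (\<phi> y) * indicator (g ` S i) y) \<partial>lebesgue)"
  proof (rule nn_integral_cong_AE, use ae in eventually_elim)
    fix y assume "y \<notin> g ` (U - R)"
    then have "{x \<in> U. g x = y} = {x \<in> (\<Union>i. S i). g x = y}"
      unfolding US by (auto simp: R_def)
    also have "emeasure (count_space UNIV) \<dots> = (\<Sum>i. indicator (g ` S i) y :: ennreal)"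
      by (rule count_fibre_eq_suminf[OF _ injS]) (simp add: S_def disjoint_family_disjointed)
    finally show "ennreal (\<phi> y) * emeasure (count_space UNIV) {x \<in> U. g x = y} =
        (\<Sum>i. ennreal (\<phi> y) * indicator (g ` S i) y)"
      by simp
  qed
  also have "\<dots> = (\<Sum>i. \<integral>\<^sup>+y. ennreal (\<phi> y) * indicator (g ` S i) y \<partial>lebesgue)"
    by (intro nn_integral_suminf) measurable
  also have "\<dots> = (\<Sum>i. \<integral>\<^sup>+x. ennreal (\<phi> (g x) * \<bar>?det x\<bar>) * indicator (S i) x \<partial>lebesgue)"
    by (simp only: cv3)
  also have "\<dots> = (\<integral>\<^sup>+x. (\<Sum>i. ennreal (\<phi> (g x) * \<bar>?det x\<bar>) * indicator (S i) x) \<partial>lebesgue)"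
    by (intro nn_integral_suminf[symmetric] cv2)
  also have "\<dots> = (\<integral>\<^sup>+x. ennreal (\<phi> (g x) * \<bar>?det x\<bar>) * indicator U x \<partial>lebesgue)"
  proof (rule nn_integral_cong)
    fix x
    have "(\<Sum>i. indicator (S i) x :: ennreal) = indicator (\<Union>i. S i) x"
      by (rule suminf_indicator) (simp add: S_def disjoint_family_disjointed)
    then show "(\<Sum>i. ennreal (\<phi> (g x) * \<bar>?det x\<bar>) * indicator (S i) x) =
        ennreal (\<phi> (g x) * \<bar>?det x\<bar>) * indicator U x"
      unfolding US by (auto simp: R_def indicator_def)
  qed
  finally show ?thesis by (simp add: nn_integral_completion)
qed

subsection \<open>The determinant of a complex matrix as a real matrix\<close>

text \<open>A permutation that moves an index outside \<open>range \<iota>\<close> meets a zero in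
  the row of that index, so only the permutations of \<open>range \<iota>\<close> survive in the
  Leibniz sum; they correspond, with the same sign, to the permutations of the small index
  type.\<close>

lemma det_embedded_block:
  fixes M :: "'a::comm_ring_1 ^ 'm ^ 'm" and \<iota> :: "'n::finite \<Rightarrow> 'm::finite"
  assumes inj: "inj \<iota>"
    and M: "\<And>m m'. m \<notin> range \<iota> \<Longrightarrow> M $ m $ m' = (if m = m' then 1 else 0)"
  shows "det M = det (\<chi> i j. M $ \<iota> i $ \<iota> j)"
proof -
  let ?S = "range \<iota>"
  let ?F = "\<lambda>p. of_int (sign p) * (\<Prod>m\<in>UNIV. M $ m $ p m)"
  have "det M = sum ?F {p. p permutes UNIV}" by (simp add: det_def)
  also have "\<dots> = sum ?F {p. p permutes ?S}"
  proof (rule sum.mono_neutral_right)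
    show "{p. p permutes ?S} \<subseteq> {p. p permutes UNIV}" by (auto intro: permutes_subset)
    show "\<forall>p\<in>{p. p permutes UNIV} - {p. p permutes ?S}. ?F p = 0"
    proof
      fix p :: "'m \<Rightarrow> 'm" assume "p \<in> {p. p permutes UNIV} - {p. p permutes ?S}"
      then obtain m where "m \<notin> ?S" "p m \<noteq> m"
        using permutes_superset[of p UNIV ?S] by auto
      then have "M $ m $ p m = 0" using M[of m "p m"] by auto
      then have "(\<Prod>m\<in>UNIV. M $ m $ p m) = 0" by (meson UNIV_I finite prod_zero)
      then show "?F p = 0" by simp
    qed
  qed auto
  also have "\<dots> = (\<Sum>q\<in>{q. q permutes UNIV}. of_int (sign q) * (\<Prod>i\<in>UNIV. M $ \<iota> i $ \<iota> (q i)))"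
  proof (rule sum.reindex_bij_witness[where i = "map_permutation UNIV \<iota>" and
        j = "map_permutation ?S (inv_into UNIV \<iota>)"])
    fix p assume "p \<in> {p. p permutes ?S}"
    then have p: "p permutes ?S" by simp
    let ?q = "map_permutation ?S (inv_into UNIV \<iota>) p"
    show pq: "map_permutation UNIV \<iota> ?q = p"
      using inj p by (intro map_permutation_compose_inv)
        (auto simp: bij_betw_def inj_on_inv_into f_inv_into_f)
    show q: "?q \<in> {q. q permutes UNIV}"
      using inj p by (simp, intro map_permutation_permutes)
        (auto simp: bij_betw_def inj_on_inv_into)
    have "sign ?q = sign p"
      using inj p by (intro sign_map_permutation) (auto simp: inj_on_inv_into)
    moreover have "(\<Prod>i\<in>UNIV. M $ \<iota> i $ \<iota> (?q i)) = (\<Prod>m\<in>UNIV. M $ m $ p m)"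
    proof -
      have "p (\<iota> i) = \<iota> (?q i)" for i
        by (subst pq[symmetric], rule map_permutation_apply) (use inj q in auto)
      then have "(\<Prod>i\<in>UNIV. M $ \<iota> i $ \<iota> (?q i)) = (\<Prod>m\<in>?S. M $ m $ p m)"
        using inj by (simp add: prod.reindex)
      also have "\<dots> = (\<Prod>m\<in>UNIV. M $ m $ p m)"
        using p M by (intro prod.mono_neutral_left) (auto simp: permutes_not_in)
      finally show ?thesis .
    qed
    ultimately show "of_int (sign ?q) * (\<Prod>i\<in>UNIV. M $ \<iota> i $ \<iota> (?q i)) = ?F p" by simp
  next
    fix q assume "q \<in> {q. q permutes (UNIV :: 'n set)}"
    then show "map_permutation ?S (inv_into UNIV \<iota>) (map_permutation UNIV \<iota> q) = q"
      using inj by (intro map_permutation_compose_inv) (auto simp: bij_betw_def)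
    show "map_permutation UNIV \<iota> q \<in> {p. p permutes ?S}"
      using inj \<open>q \<in> _\<close> by (simp, intro map_permutation_permutes) (auto simp: bij_betw_def)
  qed
  also have "\<dots> = det (\<chi> i j. M $ \<iota> i $ \<iota> j)" by (simp add: det_def)
  finally show ?thesis .
qed

lemma det_of_real: "det (\<chi> i j. complex_of_real (A $ i $ j)) = complex_of_real (det A)"
  by (simp add: det_def)

lemma det_cnj: "det (\<chi> i j. cnj (A $ i $ j)) = cnj (det A)"
  by (simp add: det_def)

text \<open>The real matrix of \<open>z \<mapsto> D *v z\<close>, where the index \<open>(i, b)\<close> stands for the real part of the
  coordinate \<open>z $ i\<close> if \<open>b\<close> is false and for its imaginary part otherwise.\<close>

definition realify :: "('m \<Rightarrow> 'n \<times> bool) \<Rightarrow> complex^'n^'n \<Rightarrow> real^'m^'m" where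
  "realify e D = (\<chi> m m'. let z = D $ fst (e m) $ fst (e m') in
     if snd (e m) = snd (e m') then Re z else if snd (e m) then Im z else - Im z)"

lemma sum_bij_bool:
  fixes e :: "'m::finite \<Rightarrow> 'n::finite \<times> bool"
  assumes "bij e"
  shows "(\<Sum>m\<in>UNIV. f m) = (\<Sum>j\<in>UNIV. f (inv e (j, False)) + f (inv e (j, True)))"
proof -
  have "(\<Sum>m\<in>UNIV. f m) = (\<Sum>p\<in>UNIV. f (inv e p))"
    using bij_imp_bij_inv[OF assms] by (rule sum.reindex_bij_betw[symmetric])
  also have "\<dots> = (\<Sum>j\<in>UNIV. \<Sum>c\<in>UNIV. f (inv e (j, c)))"
    by (simp add: sum.cartesian_product flip: UNIV_Times_UNIV)
  finally show ?thesis by (simp add: UNIV_bool add.commute)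
qed

lemma forall_bij_bool:
  assumes "bij e"
  shows "(\<forall>m. P m) \<longleftrightarrow> (\<forall>i b. P (inv e (i, b)))"
  by (metis assms bij_inv_eq_iff surj_pair)

text \<open>Over the complex numbers, the realification of \<open>D\<close> is similar to the block diagonal matrix
  with blocks \<open>D\<close> and \<open>cnj D\<close>: for \<open>D v = w\<close> it maps \<open>(v, -\<i> v)\<close> to \<open>(w, -\<i> w)\<close>.\<close>

lemma det_realify:
  fixes e :: "'m::finite \<Rightarrow> 'n::finite \<times> bool"
  assumes e: "bij e"
  shows "det (realify e D) = (cmod (det D))\<^sup>2"
proof -
  let ?g = "inv e"
  have eg [simp]: "e (?g p) = p" for p using e by (simp add: bij_is_surj surj_f_inv_f)
  have gi [simp]: "?g p = ?g q \<longleftrightarrow> p = q" for p q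
    using eg by metis
  have ge: "?g (fst (e m), snd (e m)) = m" for m using e by (simp add: bij_is_inj)
  define P :: "complex^'m^'m" where "P = (\<chi> m m'. complex_of_real (realify e D $ m $ m'))"
  \<comment> \<open>The columns of \<open>T\<close> are the vectors (v, -\<i> v) and their
    conjugates (v, \<i> v), for unit vectors v; \<open>T'\<close> is its inverse.\<close>
  define T :: "complex^'m^'m" where "T = (\<chi> m m'. if fst (e m) = fst (e m') then
     (if snd (e m) then (if snd (e m') then \<i> else - \<i>) else 1) else 0)"
  define T' :: "complex^'m^'m" where "T' = (\<chi> m m'. if fst (e m) = fst (e m') then
     (if snd (e m') then (if snd (e m) then - \<i> / 2 else \<i> / 2) else 1 / 2) else 0)"
  \<comment> \<open>Each of \<open>Q1\<close> and \<open>Q2\<close> keeps one diagonal block of the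
    block diagonal matrix and has the identity in place of the other, so that
    \<open>det_embedded_block\<close> applies to both.\<close>
  define Q1 :: "complex^'m^'m" where "Q1 = (\<chi> m m'. if snd (e m) then of_bool (m = m')
     else if snd (e m') then 0 else D $ fst (e m) $ fst (e m'))"
  define Q2 :: "complex^'m^'m" where "Q2 = (\<chi> m m'. if \<not> snd (e m) then of_bool (m = m')
     else if \<not> snd (e m') then 0 else cnj (D $ fst (e m) $ fst (e m')))"
  note simps = matrix_matrix_mult_def vec_eq_iff forall_bij_bool[OF e] sum_bij_bool[OF e] mat_def
  have "T' ** T = mat 1"
    by (simp add: simps T_def T'_def if_distrib[of "\<lambda>x. x * _"] if_distrib[of "\<lambda>x. _ * x"] sum.distrib
       cong: if_cong)
  then have TT: "det T' * det T = 1" by (metis det_I det_mul)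
  define Q :: "complex^'m^'m" where "Q = (\<chi> m m'. if snd (e m) \<noteq> snd (e m') then 0
     else if snd (e m) then cnj (D $ fst (e m) $ fst (e m')) else D $ fst (e m) $ fst (e m'))"
  have "Q1 ** Q2 = Q"
    by (simp add: simps Q_def Q1_def Q2_def if_distrib[of "\<lambda>x. x * _"] if_distrib[of "\<lambda>x. _ * x"] sum.distrib
       of_bool_def cong: if_cong)
  moreover have "P ** T = T ** Q"
    by (simp add: simps Q_def P_def T_def realify_def Let_def if_distrib[of "\<lambda>x. x * _"] if_distrib[of "\<lambda>x. _ * x"] sum.distrib
        cong: if_cong) (intro allI conjI impI; rule complex_eqI; simp)
  ultimately have PT: "P ** T = T ** (Q1 ** Q2)" by simp
  have "det P * det T = det T * (det Q1 * det Q2)"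
    using PT by (metis det_mul)
  moreover have "det T \<noteq> 0" using TT by auto
  ultimately have "det P = det Q1 * det Q2" by simp
  moreover have "det Q1 = det D"
  proof -
    have "det Q1 = det (\<chi> i j. Q1 $ ?g (i, False) $ ?g (j, False))"
    proof (rule det_embedded_block)
      show "inj (\<lambda>i. ?g (i, False))" by (simp add: inj_def)
      fix m m' assume "m \<notin> range (\<lambda>i. ?g (i, False))"
      then have "snd (e m)" using ge[of m] by (cases "snd (e m)") (simp_all, metis rangeI)
      then show "Q1 $ m $ m' = (if m = m' then 1 else 0)" by (simp add: Q1_def)
    qed
    also have "(\<chi> i j. Q1 $ ?g (i, False) $ ?g (j, False)) = D" by (simp add: Q1_def vec_eq_iff)
    finally show ?thesis .
  qed
  moreover have "det Q2 = cnj (det D)"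
  proof -
    have "det Q2 = det (\<chi> i j. Q2 $ ?g (i, True) $ ?g (j, True))"
    proof (rule det_embedded_block)
      show "inj (\<lambda>i. ?g (i, True))" by (simp add: inj_def)
      fix m m' assume "m \<notin> range (\<lambda>i. ?g (i, True))"
      then have "\<not> snd (e m)" using ge[of m] by (cases "snd (e m)") (simp_all, metis rangeI)
      then show "Q2 $ m $ m' = (if m = m' then 1 else 0)" by (simp add: Q2_def)
    qed
    also have "(\<chi> i j. Q2 $ ?g (i, True) $ ?g (j, True)) = (\<chi> i j. cnj (D $ i $ j))"
      by (simp add: Q2_def vec_eq_iff)
    finally show ?thesis by (simp add: det_cnj)
  qed
  ultimately have "complex_of_real (det (realify e D)) = det D * cnj (det D)"
    by (simp add: P_def det_of_real)
  then show ?thesis by (metis complex_norm_square of_real_eq_iff of_real_power)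
qed

subsection \<open>The area formula for holomorphic maps\<close>

definition to_real :: "('m::finite \<Rightarrow> 'n::finite \<times> bool) \<Rightarrow> complex^'n \<Rightarrow> real^'m" where
  "to_real e z = (\<chi> m. if snd (e m) then Im (z $ fst (e m)) else Re (z $ fst (e m)))"

definition of_realvec :: "('m::finite \<Rightarrow> 'n::finite \<times> bool) \<Rightarrow> real^'m \<Rightarrow> complex^'n" where
  "of_realvec e x = (\<chi> i. Complex (x $ inv e (i, False)) (x $ inv e (i, True)))"

lemma of_realvec_to_real [simp]: "bij e \<Longrightarrow> of_realvec e (to_real e z) = z"
  by (simp add: of_realvec_def to_real_def vec_eq_iff bij_is_surj surj_f_inv_f)

lemma to_real_of_realvec [simp]:
  assumes "bij e"
  shows "to_real e (of_realvec e x) = x"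
proof -
  have *: "inv e (fst (e m), snd (e m)) = m" for m using assms by (simp add: bij_is_inj)
  have "to_real e (of_realvec e x) $ m = x $ m" for m
    using *[of m] by (cases "snd (e m)") (simp_all add: of_realvec_def to_real_def)
  then show ?thesis by (simp add: vec_eq_iff)
qed

lemma bounded_linear_to_real: "bounded_linear (to_real e)"
  by (rule linear_conv_bounded_linear[THEN iffD1])
     (auto intro!: linearI simp: to_real_def vec_eq_iff)

lemma bounded_linear_of_realvec: "bounded_linear (of_realvec e)"
  by (rule linear_conv_bounded_linear[THEN iffD1])
     (auto intro!: linearI simp: of_realvec_def vec_eq_iff complex_eq_iff)

lemma matrix_realify:
  assumes e: "bij e"
  shows "matrix (\<lambda>x. to_real e (D *v of_realvec e x)) = realify e D"
proof -
  have eg: "inv e p = m \<longleftrightarrow> p = e m" for p m using e by (metis bij_inv_eq_iff)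
  have ax: "of_realvec e (axis m 1) = axis (fst (e m)) (if snd (e m) then \<i> else 1)" for m
    by (cases "e m") (auto simp: of_realvec_def vec_eq_iff axis_def eg complex_eq_iff)
  have "(D *v axis j c) $ i = D $ i $ j * c" for i j and c :: complex
    by (simp add: matrix_vector_mult_def axis_def if_distrib[of "\<lambda>x. _ * x"] cong: if_cong)
  then show ?thesis
    by (simp add: matrix_def ax) (simp add: realify_def to_real_def Let_def vec_eq_iff)
qed

text \<open>The map only regroups orthonormal coordinates, so the preimage of a box is a box with
  the same side lengths, and Lebesgue measure is determined by its values on boxes.\<close>

lemma lborel_distr_of_realvec:
  fixes e :: "'m::finite \<Rightarrow> 'n::finite \<times> bool"
  assumes e: "bij e"
  shows "distr lborel lborel (of_realvec e) = (lborel :: (complex^'n) measure)"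
proof (rule sym, rule lborel_eqI)
  have [measurable]: "of_realvec e \<in> borel_measurable borel"
    by (intro borel_measurable_continuous_onI linear_continuous_on bounded_linear_of_realvec)
  fix l u :: "complex^'n"
  assume le: "\<And>b. b \<in> Basis \<Longrightarrow> l \<bullet> b \<le> u \<bullet> b"
  have Bc: "(\<forall>b\<in>Basis. Q b) \<longleftrightarrow> (\<forall>i. Q (axis i 1) \<and> Q (axis i \<i>))" for Q :: "complex^'n \<Rightarrow> bool"
    by (auto simp: Basis_vec_def Basis_complex_def)
  have Br: "(\<forall>b\<in>Basis. Q b) \<longleftrightarrow> (\<forall>m. Q (axis m 1))" for Q :: "real^'m \<Rightarrow> bool"
    by (auto simp: Basis_vec_def)
  have vim: "of_realvec e -` box l u = box (to_real e l) (to_real e u)"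
  proof -
    have "x \<in> box (to_real e l) (to_real e u) \<longleftrightarrow> of_realvec e x \<in> box l u" for x
    proof -
      have "x \<in> box (to_real e l) (to_real e u) \<longleftrightarrow> (\<forall>m. to_real e l $ m < x $ m \<and> x $ m < to_real e u $ m)"
        unfolding box_def by (simp add: Br inner_axis)
      also have "\<dots> \<longleftrightarrow> of_realvec e x \<in> box l u"
        unfolding forall_bij_bool[OF e] box_def
        by (auto simp: Bc inner_axis inner_complex_def of_realvec_def to_real_def bij_is_surj[OF e] surj_f_inv_f
              all_bool_eq)
      finally show ?thesis .
    qed
    then show ?thesis by auto
  qed
  have le': "to_real e l \<bullet> b \<le> to_real e u \<bullet> b" if "b \<in> Basis" for b
  proof -
    have "l \<bullet> axis i 1 \<le> u \<bullet> axis i 1" "l \<bullet> axis i \<i> \<le> u \<bullet> axis i \<i>" for i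
      by (auto intro!: le simp: Basis_vec_def Basis_complex_def)
    then show ?thesis
      using that by (auto simp: Basis_vec_def inner_axis to_real_def inner_complex_def)
  qed
  have "emeasure (distr lborel lborel (of_realvec e)) (box l u) = emeasure lborel (box (to_real e l) (to_real e u))"
    by (simp add: emeasure_distr vim)
  also have "\<dots> = ennreal (\<Prod>b\<in>Basis. (to_real e u - to_real e l) \<bullet> b)"
    using le' by simp
  also have "(\<Prod>b\<in>Basis. (to_real e u - to_real e l) \<bullet> b) = (\<Prod>m\<in>UNIV. (to_real e u - to_real e l) $ m)"
  proof -
    have "bij_betw (\<lambda>m. axis m 1) UNIV (Basis :: (real^'m) set)"
      by (auto simp: Basis_vec_def bij_betw_def inj_on_def axis_eq_axis)
    from prod.reindex_bij_betw[OF this, of "\<lambda>b. (to_real e u - to_real e l) \<bullet> b"] show ?thesis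
      by (simp add: inner_axis)
  qed
  also have "\<dots> = (\<Prod>p\<in>UNIV. (to_real e u - to_real e l) $ inv e p)"
    using bij_imp_bij_inv[OF e] by (rule prod.reindex_bij_betw[symmetric])
  also have "\<dots> = (\<Prod>b\<in>Basis. (u - l) \<bullet> b)"
  proof -
    have "bij_betw (\<lambda>(i, b). axis i (if b then \<i> else 1)) UNIV (Basis :: (complex^'n) set)"
      unfolding bij_betw_def
    proof
      show "inj (\<lambda>(i::'n, b). axis i (if b then \<i> else 1 :: complex))"
        by (auto simp: inj_on_def axis_eq_axis split: if_splits)
      let ?f = "\<lambda>(i::'n, b). axis i (if b then \<i> else 1 :: complex)"
      have "x \<in> range ?f" if "x \<in> Basis" for x
      proof -
        from that obtain i where "x = axis i 1 \<or> x = axis i \<i>"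
          by (auto simp: Basis_vec_def Basis_complex_def)
        then have "x = ?f (i, False) \<or> x = ?f (i, True)" by simp
        then show ?thesis by (elim disjE) (simp_all only: rangeI)
      qed
      moreover have "?f p \<in> Basis" for p
        by (cases p) (auto simp: Basis_vec_def Basis_complex_def)
      ultimately show "range ?f = Basis" by blast
    qed
    from prod.reindex_bij_betw[OF this, of "\<lambda>b. (u - l) \<bullet> b"]
    have "(\<Prod>b\<in>Basis. (u - l) \<bullet> b) = (\<Prod>p\<in>UNIV. (u - l) \<bullet> axis (fst p) (if snd p then \<i> else 1))"
      by (simp add: split_beta)
    also have "\<dots> = (\<Prod>p\<in>UNIV. (to_real e u - to_real e l) $ inv e p)"
      by (rule prod.cong) (auto simp: inner_axis inner_complex_def to_real_def bij_is_surj[OF e] surj_f_inv_f)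
    finally show ?thesis by simp
  qed
  finally show "emeasure (distr lborel lborel (of_realvec e)) (box l u) = (\<Prod>b\<in>Basis. (u - l) \<bullet> b)" .
qed simp

text \<open>The real Jacobian of a complex linear map is the squared modulus of its determinant, by
  \<open>det_realify\<close>. Measurability of the count is a hypothesis because the left-hand
  integral has to be transported along the coordinate map.\<close>

theorem complex_area_formula:
  fixes g :: "complex^'n \<Rightarrow> complex^'n" and \<phi> :: "complex^'n \<Rightarrow> real"
  assumes U: "open U"
    and der: "\<And>z. z \<in> U \<Longrightarrow> (g has_derivative (*v) (J z)) (at z)"
    and cont: "continuous_on U J" "continuous_on U g"
    and nonneg: "\<And>y. 0 \<le> \<phi> y" and int: "integrable lborel \<phi>"
    and meas: "(\<lambda>y. emeasure (count_space UNIV) {z \<in> U. g z = y}) \<in> borel_measurable borel"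
  shows "(\<integral>\<^sup>+y. ennreal (\<phi> y) * emeasure (count_space UNIV) {z \<in> U. g z = y} \<partial>lborel) =
         (\<integral>\<^sup>+z. ennreal (\<phi> (g z) * (cmod (det (J z)))\<^sup>2) * indicator U z \<partial>lborel)"
proof -
  \<comment> \<open>The real version asks for a well-ordered index type with two elements per
    complex coordinate; \<open>'n bit0\<close> is such a type, and any bijection with
    \<open>'n \<times> bool\<close> serves.\<close>
  obtain e :: "'n bit0 \<Rightarrow> 'n \<times> bool" where e: "bij e"
    using finite_same_card_bij[of "UNIV :: 'n bit0 set" "UNIV :: ('n \<times> bool) set"]
    by (auto simp: card_UNIV_bool mult.commute)
  let ?L = "to_real e" and ?K = "of_realvec e"
  define h where "h = (\<lambda>x. ?L (g (?K x)))"
  define h' where "h' = (\<lambda>x v. ?L (J (?K x) *v ?K v))"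
  define V where "V = ?K -` U"
  have [measurable]: "?K \<in> borel_measurable borel"
    by (intro borel_measurable_continuous_onI linear_continuous_on bounded_linear_of_realvec)
  have contK: "continuous_on S ?K" for S using bounded_linear_of_realvec by (rule linear_continuous_on)
  have V: "open V" unfolding V_def using U contK by (simp add: open_vimage)
  have [measurable]: "U \<in> sets borel" "\<phi> \<in> borel_measurable borel" using U int by auto
  have m: "matrix (h' x) = realify e (J (?K x))" for x
    unfolding h'_def by (rule matrix_realify[OF e])
  have h: "(h has_derivative h' x) (at x)" if "x \<in> V" for x
  proof -
    have "(?K has_derivative ?K) (at x)" "(?L has_derivative ?L) (at (g (?K x)))"
      using bounded_linear_of_realvec bounded_linear_to_real by (auto intro: bounded_linear_imp_has_derivative)
    moreover have "(g has_derivative (*v) (J (?K x))) (at (?K x))" using that by (intro der) (simp add: V_def)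
    ultimately show ?thesis
      unfolding h_def h'_def by (auto intro: has_derivative_compose)
  qed
  have cJ: "continuous_on V (\<lambda>x. J (?K x))"
    by (rule continuous_on_compose2[OF cont(1) contK]) (auto simp: V_def)
  have c1: "continuous_on V (\<lambda>x. matrix (h' x) $ m $ m')" for m m'
    unfolding m realify_def Let_def
    by (cases "snd (e m)"; cases "snd (e m')")
       (auto intro!: continuous_intros continuous_on_component cJ)
  have "continuous_on V (\<lambda>x. \<chi> m m'. matrix (h' x) $ m $ m')"
    by (intro continuous_intros c1)
  then have ch: "continuous_on V (\<lambda>x. matrix (h' x))" by simp
  have int': "integrable lborel (\<lambda>x. \<phi> (?K x))"
    using int by (subst (asm) lborel_distr_of_realvec[OF e, symmetric]) (simp add: integrable_distr_eq)
  have count: "emeasure (count_space UNIV) {x \<in> V. h x = y} =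
      emeasure (count_space UNIV) {z \<in> U. g z = ?K y}" for y
  proof -
    have "{z \<in> U. g z = ?K y} = ?K ` {x \<in> V. h x = y}"
    proof (intro set_eqI iffI)
      fix z assume "z \<in> {z \<in> U. g z = ?K y}"
      then show "z \<in> ?K ` {x \<in> V. h x = y}"
        by (intro image_eqI[of _ _ "?L z"]) (auto simp: V_def h_def e)
    next
      fix z assume "z \<in> ?K ` {x \<in> V. h x = y}"
      then show "z \<in> {z \<in> U. g z = ?K y}"
        by (auto simp: V_def h_def e)
    qed
    moreover have "inj ?K" by (metis e injI to_real_of_realvec)
    then have "bij_betw ?K {x \<in> V. h x = y} (?K ` {x \<in> V. h x = y})"
      by (simp add: inj_on_def bij_betw_def)
    ultimately show ?thesis
      by (auto simp: emeasure_count_space bij_betw_finite bij_betw_same_card)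
  qed
  have KF [measurable]: "(\<lambda>x. F (?K x)) \<in> borel_measurable borel" if "F \<in> borel_measurable borel"
    for F :: "complex^'n \<Rightarrow> ennreal" using that by measurable
  have trans: "(\<integral>\<^sup>+z. F z \<partial>lborel) = (\<integral>\<^sup>+x. F (?K x) \<partial>lborel)"
    if [measurable]: "F \<in> borel_measurable borel" for F
    by (subst lborel_distr_of_realvec[OF e, symmetric]) (simp add: nn_integral_distr)
  have gm [measurable]: "(\<lambda>z. ennreal (\<phi> (g z) * (cmod (det (J z)))\<^sup>2) * indicator U z) \<in> borel_measurable borel"
  proof -
    \<comment> \<open>\<open>g\<close> and \<open>J\<close> are continuous only on \<open>U\<close>;
      extension by 0 gives globally measurable factors.\<close>
    have g': "(\<lambda>z. if z \<in> U then g z else 0) \<in> borel_measurable borel"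
      using U cont(2) by (intro borel_measurable_continuous_on_if) auto
    have "continuous_on U (\<lambda>z. (cmod (det (J z)))\<^sup>2)"
      unfolding det_def by (intro continuous_intros continuous_on_component cont)
    then have J': "(\<lambda>z. if z \<in> U then (cmod (det (J z)))\<^sup>2 else 0) \<in> borel_measurable borel"
      using U by (intro borel_measurable_continuous_on_if) auto
    have "(\<lambda>z. ennreal (\<phi> (if z \<in> U then g z else 0) * (if z \<in> U then (cmod (det (J z)))\<^sup>2 else 0)))
        \<in> borel_measurable borel"
      using measurable_compose[OF g' \<open>\<phi> \<in> _\<close>] J' by measurable
    also have "(\<lambda>z. ennreal (\<phi> (if z \<in> U then g z else 0) * (if z \<in> U then (cmod (det (J z)))\<^sup>2 else 0))) =
       (\<lambda>z. ennreal (\<phi> (g z) * (cmod (det (J z)))\<^sup>2) * indicator U z)"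
      by (auto simp: fun_eq_iff)
    finally show ?thesis .
  qed
  have "(\<integral>\<^sup>+y. ennreal (\<phi> y) * emeasure (count_space UNIV) {z \<in> U. g z = y} \<partial>lborel) =
      (\<integral>\<^sup>+y. ennreal (\<phi> (?K y)) * emeasure (count_space UNIV) {x \<in> V. h x = y} \<partial>lborel)"
    using meas by (subst trans) (auto simp: count)
  also have "\<dots> = (\<integral>\<^sup>+x. ennreal (\<phi> (?K (h x)) * \<bar>det (matrix (h' x))\<bar>) * indicator V x \<partial>lborel)"
    by (rule area_formula[OF V h ch nonneg int'])
  also have "\<dots> = (\<integral>\<^sup>+x. ennreal (\<phi> (g (?K x)) * (cmod (det (J (?K x))))\<^sup>2) * indicator U (?K x) \<partial>lborel)"
    by (intro nn_integral_cong) (simp add: m h_def e det_realify V_def indicator_def)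
  also have "\<dots> = (\<integral>\<^sup>+z. ennreal (\<phi> (g z) * (cmod (det (J z)))\<^sup>2) * indicator U z \<partial>lborel)"
    by (rule trans[OF gm, symmetric])
  finally show ?thesis .
qed

subsection \<open>Measurability of the number of zeros\<close>

text \<open>On a compact set the norm of a continuous function attains its minimum, so a zero exists
  as soon as the values on a countable dense subset come arbitrarily close to 0. An uncountable
  union thus becomes countable set operations.\<close>

lemma sets_exists_zero_compact:
  fixes F :: "'a::euclidean_space \<Rightarrow> 'w \<Rightarrow> 'b::euclidean_space"
  assumes K: "compact K"
    and meas: "\<And>z. z \<in> K \<Longrightarrow> F z \<in> borel_measurable N"
    and cont: "\<And>\<omega>. \<omega> \<in> space N \<Longrightarrow> continuous_on K (\<lambda>z. F z \<omega>)"
  shows "{\<omega> \<in> space N. \<exists>z\<in>K. F z \<omega> = 0} \<in> sets N"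
proof -
  obtain D where D: "countable D" "D \<subseteq> K" "K \<subseteq> closure D" by (rule separable)
  have "(\<exists>z\<in>K. F z \<omega> = 0) \<longleftrightarrow> (\<forall>m. \<exists>z\<in>D. norm (F z \<omega>) < inverse (real (Suc m)))"
    if \<omega>: "\<omega> \<in> space N" for \<omega>
  proof
    assume "\<exists>z\<in>K. F z \<omega> = 0"
    then obtain z where z: "z \<in> K" "F z \<omega> = 0" by auto
    show "\<forall>m. \<exists>z\<in>D. norm (F z \<omega>) < inverse (real (Suc m))"
    proof
      fix m
      obtain d where d: "d > 0" "\<And>x. x \<in> K \<Longrightarrow> dist x z < d \<Longrightarrow> dist (F x \<omega>) (F z \<omega>) < inverse (real (Suc m))"
        using cont[OF \<omega>] z(1) unfolding continuous_on_iff
        by (metis inverse_positive_iff_positive of_nat_0_less_iff zero_less_Suc)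
      have "z \<in> closure D" using z D by auto
      then obtain x where "x \<in> D" "dist x z < d" using d(1) closure_approachable by blast
      then show "\<exists>z\<in>D. norm (F z \<omega>) < inverse (real (Suc m))"
        using d(2)[of x] z D(2) by (auto simp: dist_norm)
    qed
  next
    assume R: "\<forall>m. \<exists>z\<in>D. norm (F z \<omega>) < inverse (real (Suc m))"
    then have "K \<noteq> {}" using D by fastforce
    then obtain z where z: "z \<in> K" "\<And>y. y \<in> K \<Longrightarrow> norm (F z \<omega>) \<le> norm (F y \<omega>)"
      using continuous_attains_inf[OF K _ continuous_on_norm[OF cont[OF \<omega>]]] by blast
    have "\<not> 0 < norm (F z \<omega>)"
    proof
      assume "0 < norm (F z \<omega>)"
      then obtain m where "inverse (real (Suc m)) < norm (F z \<omega>)" by (rule reals_Archimedean[THEN exE])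
      with R z D(2) show False by (meson less_trans not_le subsetD)
    qed
    with z show "\<exists>z\<in>K. F z \<omega> = 0" by auto
  qed
  then have "{\<omega> \<in> space N. \<exists>z\<in>K. F z \<omega> = 0} =
      {\<omega> \<in> space N. \<forall>m. \<exists>z\<in>D. norm (F z \<omega>) < inverse (real (Suc m))}"
    by auto
  also have "\<dots> = (\<Inter>m. \<Union>z\<in>D. {\<omega> \<in> space N. norm (F z \<omega>) < inverse (real (Suc m))})"
    by auto
  also have "\<dots> \<in> sets N"
  proof (intro sets.countable_INT sets.countable_UN' D(1) image_subsetI)
    fix m z assume "z \<in> D"
    then have [measurable]: "F z \<in> borel_measurable N" using meas D by auto
    show "{\<omega> \<in> space N. norm (F z \<omega>) < inverse (real (Suc m))} \<in> sets N" by measurable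
  qed auto
  finally show ?thesis .
qed

text \<open>Sufficiently small members of a countable base have compact closures; the other closures
  are discarded.\<close>

lemma countable_compact_neighbourhoods:
  obtains \<B> :: "'a::euclidean_space set set"
  where "countable \<B>" "\<And>K. K \<in> \<B> \<Longrightarrow> compact K"
    "\<And>W z. open W \<Longrightarrow> z \<in> W \<Longrightarrow> \<exists>K\<in>\<B>. z \<in> K \<and> K \<subseteq> W"
proof -
  obtain B :: "'a set set" where B: "countable B" "topological_basis B"
    using ex_countable_basis by auto
  show ?thesis
  proof (rule that[of "{K \<in> closure ` B. compact K}"])
    show "countable {K \<in> closure ` B. compact K}" using B by (auto intro: countable_subset[of _ "closure ` B"])
    fix W :: "'a set" and z assume "open W" "z \<in> W"
    then obtain r where r: "r > 0" "cball z r \<subseteq> W" using open_contains_cball by blast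
    then obtain b where b: "b \<in> B" "z \<in> b" "b \<subseteq> ball z r"
      using topological_basisE[OF B(2) open_ball, of z z r] by auto
    then have "closure b \<subseteq> cball z r" by (meson ball_subset_cball closed_cball closure_minimal order_trans)
    moreover from this have "compact (closure b)"
      by (meson bounded_cball bounded_subset closed_closure compact_eq_bounded_closed)
    ultimately show "\<exists>K\<in>{K \<in> closure ` B. compact K}. z \<in> K \<and> K \<subseteq> W"
      using b r closure_subset[of b] by (intro bexI[of _ "closure b"]) auto
  qed auto
qed

lemma card_le_emeasure_count_space:
  assumes "finite T" "T \<subseteq> Z"
  shows "of_nat (card T) \<le> emeasure (count_space UNIV) Z"
proof -
  have "of_nat (card T) = emeasure (count_space UNIV) T" using assms by simp
  also have "\<dots> \<le> emeasure (count_space UNIV) Z" using assms by (intro emeasure_mono) auto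
  finally show ?thesis .
qed

text \<open>An infinite set contains finite subsets of every size, which forces \<open>c\<close> to
  be \<infinity>.\<close>

lemma emeasure_count_space_le:
  assumes "\<And>T. finite T \<Longrightarrow> T \<subseteq> Z \<Longrightarrow> of_nat (card T) \<le> c"
  shows "emeasure (count_space UNIV) Z \<le> c"
proof (cases "finite Z")
  case False
  have "of_nat n \<le> c" for n
    using infinite_arbitrarily_large[OF False, of n] assms by auto
  then have "c = \<top>" by (meson ennreal_Ex_less_of_nat not_le less_top)
  then show ?thesis by simp
qed (use assms in auto)

lemma finite_separated:
  fixes T :: "'a::metric_space set"
  assumes "finite T"
  obtains d where "d > 0" "\<And>s t. s \<in> T \<Longrightarrow> t \<in> T \<Longrightarrow> s \<noteq> t \<Longrightarrow> ball s d \<inter> ball t d = {}"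
proof -
  define P where "P = {p \<in> T \<times> T. fst p \<noteq> snd p}"
  have "finite P" using assms by (simp add: P_def)
  \<comment> \<open>Half the least distance between distinct points, capped at 1; the 1 also keeps
    \<open>Min\<close> meaningful when \<open>T\<close> has fewer than two points.\<close>
  define d where "d = Min (insert 1 ((\<lambda>p. dist (fst p) (snd p) / 2) ` P))"
  have "d > 0" unfolding d_def using \<open>finite P\<close> by (auto simp: P_def)
  moreover have "ball s d \<inter> ball t d = {}" if "s \<in> T" "t \<in> T" "s \<noteq> t" for s t
  proof (rule ccontr)
    assume "ball s d \<inter> ball t d \<noteq> {}"
    then obtain x where "dist s x < d" "dist t x < d" by auto
    then have "dist s t < 2 * d" using dist_triangle2[of s t x] by simp
    moreover have "d \<le> dist s t / 2"
      unfolding d_def using \<open>finite P\<close> that by (intro Min_le) (auto simp: P_def image_iff)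
    ultimately show False by simp
  qed
  ultimately show ?thesis by (rule that)
qed

text \<open>The number of points of a set is the supremum, over the finite disjoint families of a countable
  neighbourhood base of compact sets, of the number of members of the family that meet the set.\<close>

theorem borel_measurable_count_zeros:
  fixes F :: "'a::euclidean_space \<Rightarrow> 'w \<Rightarrow> 'b::euclidean_space"
  assumes U: "open U"
    and meas: "\<And>z. z \<in> U \<Longrightarrow> F z \<in> borel_measurable N"
    and cont: "\<And>\<omega>. \<omega> \<in> space N \<Longrightarrow> continuous_on U (\<lambda>z. F z \<omega>)"
  shows "(\<lambda>\<omega>. emeasure (count_space UNIV) {z \<in> U. F z \<omega> = 0}) \<in> borel_measurable N"
proof -
  obtain \<B> :: "'a set set" where \<B>: "countable \<B>" "\<And>K. K \<in> \<B> \<Longrightarrow> compact K"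
    "\<And>W z. open W \<Longrightarrow> z \<in> W \<Longrightarrow> \<exists>K\<in>\<B>. z \<in> K \<and> K \<subseteq> W"
    using countable_compact_neighbourhoods[where ?'a = 'a] by blast
  define \<F> where "\<F> = {f. finite f \<and> f \<subseteq> {K \<in> \<B>. K \<subseteq> U} \<and> disjoint f}"
  have "countable {f. finite f \<and> f \<subseteq> {K \<in> \<B>. K \<subseteq> U}}"
    using \<B>(1) by (intro countable_Collect_finite_subset) (auto intro: countable_subset)
  then have c\<F>: "countable \<F>" unfolding \<F>_def by (rule countable_subset[rotated]) auto
  let ?E = "\<lambda>K. {\<omega> \<in> space N. \<exists>z\<in>K. F z \<omega> = 0}"
  let ?S = "\<lambda>f \<omega>. \<Sum>K\<in>f. indicator (?E K) \<omega> :: ennreal"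
  have E: "?E K \<in> sets N" if "K \<in> \<B>" "K \<subseteq> U" for K
    using that \<B>(2) meas cont by (intro sets_exists_zero_compact) (auto intro: continuous_on_subset[of U])
  have eq: "emeasure (count_space UNIV) {z \<in> U. F z \<omega> = 0} = (SUP f\<in>\<F>. ?S f \<omega>)"
    (is "?l = ?r") if \<omega>: "\<omega> \<in> space N" for \<omega>
  proof (rule antisym)
    show "?r \<le> ?l"
    proof (rule SUP_least)
      fix f assume "f \<in> \<F>"
      then have f: "f \<subseteq> {K \<in> \<B>. K \<subseteq> U}" "finite f" "disjoint f" by (auto simp: \<F>_def)
      \<comment> \<open>One zero is picked in every member of \<open>f\<close> that contains one;
        disjointness makes the picks distinct, so such members are no more numerous than the zeros
        in \<open>U\<close>.\<close>
      define f' where "f' = {K \<in> f. \<exists>z\<in>K. F z \<omega> = 0}"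
      have "\<forall>K\<in>f'. \<exists>z. z \<in> K \<and> F z \<omega> = 0" by (auto simp: f'_def)
      then obtain p where p: "\<And>K. K \<in> f' \<Longrightarrow> p K \<in> K \<and> F (p K) \<omega> = 0" by metis
      have "inj_on p f'"
      proof (rule inj_onI, rule ccontr)
        fix K L assume "K \<in> f'" "L \<in> f'" "p K = p L" "K \<noteq> L"
        moreover from this have "K \<inter> L = {}" using f(3) by (auto simp: f'_def disjoint_def)
        ultimately show False using p[of K] p[of L] by auto
      qed
      moreover have "?S f \<omega> = of_nat (card f')"
        using f(2) \<omega> by (simp add: indicator_def f'_def sum.If_cases Int_def)
      moreover have "of_nat (card (p ` f')) \<le> ?l"
        using f p by (intro card_le_emeasure_count_space) (auto simp: f'_def)
      ultimately show "?S f \<omega> \<le> ?l" by (simp add: card_image)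
    qed
    show "?l \<le> ?r"
    proof (rule emeasure_count_space_le)
      \<comment> \<open>Conversely, finitely many zeros are separated by disjoint balls, and a
        compact neighbourhood inside each ball yields a disjoint family all of whose members meet
        the zero set.\<close>
      fix T assume T: "finite T" "T \<subseteq> {z \<in> U. F z \<omega> = 0}"
      obtain d where d: "d > 0" "\<And>s t. s \<in> T \<Longrightarrow> t \<in> T \<Longrightarrow> s \<noteq> t \<Longrightarrow> ball s d \<inter> ball t d = {}"
        using finite_separated[OF T(1)] by metis
      have "\<forall>t\<in>T. \<exists>K\<in>\<B>. t \<in> K \<and> K \<subseteq> U \<inter> ball t d"
        using T d U by (intro ballI \<B>(3)) auto
      then obtain K where K: "\<And>t. t \<in> T \<Longrightarrow> K t \<in> \<B> \<and> t \<in> K t \<and> K t \<subseteq> U \<inter> ball t d" by metis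
      have disj: "K s \<inter> K t = {}" if "s \<in> T" "t \<in> T" "s \<noteq> t" for s t
        using K[OF that(1)] K[OF that(2)] d(2)[OF that] by auto
      have "inj_on K T"
      proof (rule inj_onI, rule ccontr)
        fix s t assume "s \<in> T" "t \<in> T" "K s = K t" "s \<noteq> t"
        then show False using disj[of s t] K[of s] by auto
      qed
      then have "?S (K ` T) \<omega> = (\<Sum>t\<in>T. indicator (?E (K t)) \<omega>)"
        by (simp add: sum.reindex)
      also have "\<dots> = (\<Sum>t\<in>T. 1)"
        using K T(2) \<omega> by (intro sum.cong) (auto simp: indicator_def)
      finally have "of_nat (card T) = ?S (K ` T) \<omega>" by simp
      also have "\<dots> \<le> ?r"
      proof (rule SUP_upper)
        show "K ` T \<in> \<F>"
        proof -
          have "disjoint (K ` T)"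
            unfolding disjoint_def using disj by (metis (no_types, lifting) imageE)
          then show ?thesis using K T(1) by (auto simp: \<F>_def)
        qed
      qed
      finally show "of_nat (card T) \<le> ?r" .
    qed
  qed
  have "(\<lambda>\<omega>. SUP f\<in>\<F>. ?S f \<omega>) \<in> borel_measurable N"
    using E by (intro borel_measurable_SUP c\<F> borel_measurable_sum borel_measurable_indicator)
      (auto simp: \<F>_def)
  then show ?thesis using eq by (subst measurable_cong) auto
qed

subsection \<open>Gaussian integrals\<close>

lemma measurable_Complex_pair [measurable]:
  "(\<lambda>p. Complex (fst p) (snd p)) \<in> borel_measurable (lborel \<Otimes>\<^sub>M lborel)"
proof -
  have "(\<lambda>p :: real \<times> real. complex_of_real (fst p) + \<i> * complex_of_real (snd p)) \<in> borel_measurable borel"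
    by (intro borel_measurable_continuous_onI continuous_intros)
  then show ?thesis by (simp add: Complex_eq lborel_prod)
qed

lemma lborel_complex_eq_distr:
  "(lborel :: complex measure) = distr (lborel \<Otimes>\<^sub>M lborel) borel (\<lambda>p. Complex (fst p) (snd p))"
proof (rule lborel_eqI)
  fix l u :: complex assume le: "\<And>b. b \<in> Basis \<Longrightarrow> l \<bullet> b \<le> u \<bullet> b"
  have le': "Re l \<le> Re u" "Im l \<le> Im u"
    using le[of 1] le[of \<i>] by (auto simp: Basis_complex_def inner_complex_def)
  have eq: "(\<lambda>p. Complex (fst p) (snd p)) -` box l u = {Re l <..< Re u} \<times> {Im l <..< Im u}"
    by (auto simp: box_def Basis_complex_def inner_complex_def)
  have "emeasure (distr (lborel \<Otimes>\<^sub>M lborel) borel (\<lambda>p. Complex (fst p) (snd p))) (box l u)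
      = emeasure (lborel \<Otimes>\<^sub>M lborel) ({Re l <..< Re u} \<times> {Im l <..< Im u})"
    by (subst emeasure_distr) (simp_all add: eq space_pair_measure)
  also have "\<dots> = ennreal ((Re u - Re l) * (Im u - Im l))"
    using le' by (simp add: lborel.emeasure_pair_measure_Times ennreal_mult)
  also have "(Re u - Re l) * (Im u - Im l) = (\<Prod>b\<in>Basis. (u - l) \<bullet> b)"
    by (simp add: Basis_complex_def inner_complex_def)
  finally show "emeasure (distr (lborel \<Otimes>\<^sub>M lborel) borel (\<lambda>p. Complex (fst p) (snd p))) (box l u) =
      (\<Prod>b\<in>Basis. (u - l) \<bullet> b)" .
qed simp

lemma nn_integral_lborel_complex:
  assumes [measurable]: "F \<in> borel_measurable borel"
  shows "(\<integral>\<^sup>+z. F z \<partial>lborel) = (\<integral>\<^sup>+x. \<integral>\<^sup>+y. F (Complex x y) \<partial>lborel \<partial>lborel)"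
proof -
  have "(\<integral>\<^sup>+z. F z \<partial>lborel) = (\<integral>\<^sup>+p. F (Complex (fst p) (snd p)) \<partial>(lborel \<Otimes>\<^sub>M lborel))"
    by (subst lborel_complex_eq_distr) (simp add: nn_integral_distr)
  also have "\<dots> = (\<integral>\<^sup>+x. \<integral>\<^sup>+y. F (Complex x y) \<partial>lborel \<partial>lborel)"
    by (subst lborel.nn_integral_fst[symmetric]) auto
  finally show ?thesis .
qed

lemma gaussian_integral_real:
  fixes c :: real assumes c: "c > 0"
  shows "(\<integral>\<^sup>+x. ennreal (exp (- c * x\<^sup>2)) \<partial>lborel) = ennreal (sqrt (pi / c))"
    and "(\<integral>\<^sup>+x. ennreal (x\<^sup>2 * exp (- c * x\<^sup>2)) \<partial>lborel) = ennreal (sqrt (pi / c) / (2 * c))"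
proof -
  \<comment> \<open>This variance turns the exponent of the normal density into -c x^2; the two
    integrals are then moments of order 0 and 2.\<close>
  define \<sigma> where "\<sigma> = sqrt (1 / (2 * c))"
  have \<sigma>: "\<sigma> > 0" "\<sigma>\<^sup>2 = 1 / (2 * c)" using c by (auto simp: \<sigma>_def)
  have nd: "normal_density 0 \<sigma> x = exp (- c * x\<^sup>2) / sqrt (pi / c)" for x
    using c unfolding normal_density_def \<sigma>(2) by (simp add: field_simps)
  have s: "sqrt (pi / c) > 0" using c by simp
  have "has_bochner_integral lborel (\<lambda>x. sqrt (pi / c) * (normal_density 0 \<sigma> x * (x - 0) ^ (2 * 0)))
      (sqrt (pi / c) * (fact (2 * 0) / ((2 / \<sigma>\<^sup>2)^0 * fact 0)))"
    by (intro has_bochner_integral_mult_right normal_moment_even \<sigma>)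
  then have "has_bochner_integral lborel (\<lambda>x. exp (- c * x\<^sup>2)) (sqrt (pi / c))"
    using s c by (simp add: nd)
  then show "(\<integral>\<^sup>+x. ennreal (exp (- c * x\<^sup>2)) \<partial>lborel) = ennreal (sqrt (pi / c))"
    by (subst nn_integral_eq_integral) (auto simp: has_bochner_integral_iff)
  have "has_bochner_integral lborel (\<lambda>x. sqrt (pi / c) * (normal_density 0 \<sigma> x * (x - 0) ^ (2 * 1)))
      (sqrt (pi / c) * (fact (2 * 1) / ((2 / \<sigma>\<^sup>2)^1 * fact 1)))"
    by (intro has_bochner_integral_mult_right normal_moment_even \<sigma>)
  then have "has_bochner_integral lborel (\<lambda>x. x\<^sup>2 * exp (- c * x\<^sup>2)) (sqrt (pi / c) / (2 * c))"
    using s c unfolding nd \<sigma>(2) by (simp add: mult.commute)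
  then show "(\<integral>\<^sup>+x. ennreal (x\<^sup>2 * exp (- c * x\<^sup>2)) \<partial>lborel) = ennreal (sqrt (pi / c) / (2 * c))"
    by (subst nn_integral_eq_integral) (auto simp: has_bochner_integral_iff)
qed

lemma gaussian_integral_complex_0:
  fixes c :: real assumes c: "c > 0"
  shows "has_bochner_integral lborel (\<lambda>z::complex. exp (- c * (cmod z)\<^sup>2)) (pi / c)"
proof (rule has_bochner_integral_nn_integral)
  have "(\<integral>\<^sup>+z. ennreal (exp (- c * (cmod z)\<^sup>2)) \<partial>lborel) =
      (\<integral>\<^sup>+x. \<integral>\<^sup>+y. ennreal (exp (- c * x\<^sup>2)) * ennreal (exp (- c * y\<^sup>2)) \<partial>lborel \<partial>lborel)"
    by (subst nn_integral_lborel_complex)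
       (auto simp: cmod_power2 ring_distribs mult_exp_exp simp flip: ennreal_mult)
  also have "\<dots> = ennreal (sqrt (pi / c)) * ennreal (sqrt (pi / c))"
    by (simp add: nn_integral_cmult nn_integral_multc gaussian_integral_real(1)[OF c, simplified])
  also have "\<dots> = ennreal (pi / c)" using c by (simp flip: ennreal_mult)
  finally show "(\<integral>\<^sup>+z. ennreal (exp (- c * (cmod z)\<^sup>2)) \<partial>lborel) = ennreal (pi / c)" .
qed (use c in auto)

lemma gaussian_integral_complex_2:
  fixes c :: real assumes c: "c > 0"
  shows "has_bochner_integral lborel (\<lambda>z::complex. (cmod z)\<^sup>2 * exp (- c * (cmod z)\<^sup>2)) (pi / c\<^sup>2)"
proof (rule has_bochner_integral_nn_integral)
  let ?e = "\<lambda>x. ennreal (exp (- c * x\<^sup>2))" and ?s = "\<lambda>x. ennreal (x\<^sup>2 * exp (- c * x\<^sup>2))"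
  have "(\<integral>\<^sup>+z. ennreal ((cmod z)\<^sup>2 * exp (- c * (cmod z)\<^sup>2)) \<partial>lborel) =
      (\<integral>\<^sup>+x. \<integral>\<^sup>+y. ?s x * ?e y + ?e x * ?s y \<partial>lborel \<partial>lborel)"
    by (subst nn_integral_lborel_complex)
       (auto simp: cmod_power2 ring_distribs exp_diff exp_minus field_simps intro!: nn_integral_cong
          simp flip: ennreal_mult ennreal_plus)
  also have "\<dots> = ennreal (sqrt (pi / c) / (2 * c)) * ennreal (sqrt (pi / c))
     + ennreal (sqrt (pi / c)) * ennreal (sqrt (pi / c) / (2 * c))"
    by (simp add: nn_integral_add nn_integral_cmult nn_integral_multc gaussian_integral_real[OF c, simplified])
  also have "\<dots> = ennreal (pi / c\<^sup>2)"
    using c by (simp add: field_simps power2_eq_square flip: ennreal_mult ennreal_plus)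
  finally show "(\<integral>\<^sup>+z. ennreal ((cmod z)\<^sup>2 * exp (- c * (cmod z)\<^sup>2)) \<partial>lborel) = ennreal (pi / c\<^sup>2)" .
qed (use c in auto)

lemma lborel_distr_uminus_euclidean: "distr lborel borel uminus = (lborel :: 'a::euclidean_space measure)"
  by (subst lborel_affine[of "-1" 0]) (auto simp: density_1)

text \<open>The integrand is odd. Integrability comes from |z| \<le> 1 + |z|^2, which reduces it to
  the moments of order 0 and 2.\<close>

lemma gaussian_integral_complex_1:
  fixes c :: real assumes c: "c > 0"
  shows "has_bochner_integral lborel (\<lambda>z::complex. z * exp (- c * (cmod z)\<^sup>2)) 0"
proof -
  let ?f = "\<lambda>z::complex. z * exp (- c * (cmod z)\<^sup>2)"
  have "integrable lborel (\<lambda>z::complex. exp (- c * (cmod z)\<^sup>2) + (cmod z)\<^sup>2 * exp (- c * (cmod z)\<^sup>2))"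
    using gaussian_integral_complex_0[OF c] gaussian_integral_complex_2[OF c]
    by (intro Bochner_Integration.integrable_add) (auto simp: has_bochner_integral_iff)
  moreover have "norm (?f z) \<le> norm (exp (- c * (cmod z)\<^sup>2) + (cmod z)\<^sup>2 * exp (- c * (cmod z)\<^sup>2))" for z
  proof -
    have "cmod z \<le> 1 + (cmod z)\<^sup>2"
      using sum_power2_ge_zero[of "cmod z - 1/2" 0] by (simp add: power2_eq_square algebra_simps)
    then have "cmod z * exp (- c * (cmod z)\<^sup>2) \<le> (1 + (cmod z)\<^sup>2) * exp (- c * (cmod z)\<^sup>2)"
      by (rule mult_right_mono) simp
    then show ?thesis by (simp add: norm_mult ring_distribs)
  qed
  ultimately have int: "integrable lborel ?f"
    by (elim Bochner_Integration.integrable_bound) auto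
  have "integral\<^sup>L lborel ?f = (\<integral>z. ?f (- z) \<partial>lborel)"
    by (subst lborel_distr_uminus_euclidean[symmetric]) (simp add: integral_distr)
  also have "\<dots> = - integral\<^sup>L lborel ?f" by simp
  finally have "integral\<^sup>L lborel ?f = 0" by simp
  with int show ?thesis by (simp add: has_bochner_integral_iff)
qed

lemma has_bochner_integral_lborel_translate:
  fixes f :: "'a::euclidean_space \<Rightarrow> 'b::{banach, second_countable_topology}"
  assumes "has_bochner_integral lborel f I"
  shows "has_bochner_integral lborel (\<lambda>x. f (c + x)) I"
proof -
  have f [measurable]: "f \<in> borel_measurable borel"
    using assms by (auto simp: has_bochner_integral_iff dest: borel_measurable_integrable)
  have "has_bochner_integral (distr lborel borel ((+) c)) f I"
    using assms by (simp add: lborel_distr_plus)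
  then show ?thesis
    by (simp add: has_bochner_integral_iff integrable_distr_eq integral_distr)
qed

text \<open>The law of a standard complex Gaussian: real and imaginary parts of variance 1/2 give
  the exponent -|z|^2 and the normalising constant 1 / \<pi>. The link to
  \<open>std_complex_gaussian\<close> is \<open>distr_std_complex_gaussian\<close>.\<close>

definition complex_gaussian :: "complex measure" where
  "complex_gaussian = density lborel (\<lambda>z. ennreal (exp (- (cmod z)\<^sup>2) / pi))"

lemma sets_complex_gaussian [simp, measurable_cong]: "sets complex_gaussian = sets borel"
  and space_complex_gaussian [simp]: "space complex_gaussian = UNIV"
  by (simp_all add: complex_gaussian_def)

lemma has_bochner_integral_complex_gaussian:
  fixes f :: "complex \<Rightarrow> 'b::{banach, second_countable_topology}"
  assumes [measurable]: "f \<in> borel_measurable borel"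
    and "has_bochner_integral lborel (\<lambda>z. exp (- (cmod z)\<^sup>2) *\<^sub>R f z) (pi *\<^sub>R I)"
  shows "has_bochner_integral complex_gaussian f I"
  unfolding complex_gaussian_def
proof (rule has_bochner_integral_density)
  have "has_bochner_integral lborel (\<lambda>z. (1 / pi) *\<^sub>R (exp (- (cmod z)\<^sup>2) *\<^sub>R f z)) ((1 / pi) *\<^sub>R (pi *\<^sub>R I))"
    by (intro has_bochner_integral_scaleR_right assms)
  then show "has_bochner_integral lborel (\<lambda>z. (exp (- (cmod z)\<^sup>2) / pi) *\<^sub>R f z) I" by simp
qed auto

text \<open>The square is completed in \<open>x\<close>: the coefficient of |x|^2 is c, the minimum
  lies at x = -(t / c) cnj w y, and |y|^2 is left with the coefficient t - t^2 |w|^2 / c = t /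
  c.\<close>

lemma gaussian_complete_square:
  fixes x y w :: complex and t :: real
  assumes t: "t \<ge> 0"
  defines "c \<equiv> 1 + t * (cmod w)\<^sup>2"
  shows "(cmod x)\<^sup>2 + t * (cmod (y + w * x))\<^sup>2 =
    c * (cmod (of_real (t / c) * cnj w * y + x))\<^sup>2 + t / c * (cmod y)\<^sup>2"
proof -
  have c: "c > 0" using t by (simp add: c_def add_pos_nonneg)
  define q where "q = t / c"
  have q: "q * (1 + t * ((Re w)\<^sup>2 + (Im w)\<^sup>2)) = t"
    using c by (simp add: q_def c_def cmod_power2)
  \<comment> \<open>In real coordinates the difference of the two sides is a multiple of q c - t,
    which vanishes by the choice of q. Exhibiting that multiple makes the identity polynomial, free
    of division.\<close>
  have id: "(1 + t * (w1\<^sup>2 + w2\<^sup>2)) * ((q * (w1 * y1 + w2 * y2) + x1)\<^sup>2 + (q * (w1 * y2 - w2 * y1) + x2)\<^sup>2)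
      + q * (y1\<^sup>2 + y2\<^sup>2)
      - (x1\<^sup>2 + x2\<^sup>2 + t * ((y1 + (w1 * x1 - w2 * x2))\<^sup>2 + (y2 + (w1 * x2 + w2 * x1))\<^sup>2)) =
      (q * (1 + t * (w1\<^sup>2 + w2\<^sup>2)) - t) * (q * (w1\<^sup>2 + w2\<^sup>2) * (y1\<^sup>2 + y2\<^sup>2) + (y1\<^sup>2 + y2\<^sup>2)
        + 2 * ((w1 * y1 + w2 * y2) * x1 + (w1 * y2 - w2 * y1) * x2))" for x1 x2 y1 y2 w1 w2 :: real
    by algebra
  show ?thesis
    using id[of "Re w" "Im w" "Re y" "Im y" "Re x" "Im x"] q
    unfolding q_def[symmetric] by (simp add: c_def cmod_power2 mult.assoc flip: right_diff_distrib)
qed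

lemma exp_gaussian_complete_square:
  fixes x y w :: complex and t :: real
  assumes t: "t \<ge> 0"
  defines "c \<equiv> 1 + t * (cmod w)\<^sup>2"
  shows "exp (- (cmod x)\<^sup>2) * exp (- t * (cmod (y + w * x))\<^sup>2) =
    exp (- t / c * (cmod y)\<^sup>2) * exp (- c * (cmod (of_real (t / c) * cnj w * y + x))\<^sup>2)"
  unfolding mult_exp_exp exp_inj_iff
  using gaussian_complete_square[OF t, of x y w, folded c_def]
  by (simp only: mult_minus_left minus_divide_left[symmetric])

text \<open>Integrating one coordinate reproduces a weight of the same shape in \<open>y\<close>,
  with \<open>t\<close> replaced by t / c and a factor 1 / c. This stability allows the coordinates
  to be integrated one at a time.\<close>

lemma complex_gaussian_tilted_0:
  fixes y w :: complex and t :: real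
  assumes t: "t \<ge> 0"
  defines "c \<equiv> 1 + t * (cmod w)\<^sup>2"
  shows "(\<integral>x. exp (- t * (cmod (y + w * x))\<^sup>2) \<partial>complex_gaussian) = exp (- t / c * (cmod y)\<^sup>2) / c"
proof -
  have c: "c > 0" using t by (simp add: c_def add_pos_nonneg)
  let ?m = "of_real (t / c) * cnj w * y" and ?E = "exp (- t / c * (cmod y)\<^sup>2)"
  have "has_bochner_integral lborel (\<lambda>x. ?E * exp (- c * (cmod (?m + x))\<^sup>2)) (?E * (pi / c))"
    by (intro has_bochner_integral_mult_right
        has_bochner_integral_lborel_translate[where f = "\<lambda>x. exp (- c * (cmod x)\<^sup>2)"] gaussian_integral_complex_0 c)
  then have "has_bochner_integral complex_gaussian (\<lambda>x. exp (- t * (cmod (y + w * x))\<^sup>2)) (?E / c)"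
    using exp_gaussian_complete_square[OF t, where y = y and w = w, folded c_def]
    by (intro has_bochner_integral_complex_gaussian) (auto simp: mult.commute)
  then show ?thesis by (rule has_bochner_integral_integral_eq)
qed

text \<open>The value is the total mass exp (-(t / c) |y|^2) / c times the mean -(t / c) cnj w y of
  the tilted law.\<close>

lemma complex_gaussian_tilted_1:
  fixes y w :: complex and t :: real
  assumes t: "t \<ge> 0"
  defines "c \<equiv> 1 + t * (cmod w)\<^sup>2"
  shows "(\<integral>x. exp (- t * (cmod (y + w * x))\<^sup>2) *\<^sub>R x \<partial>complex_gaussian) =
    - (of_real (t * exp (- t / c * (cmod y)\<^sup>2) / c\<^sup>2) * cnj w * y)"
proof -
  have c: "c > 0" using t by (simp add: c_def add_pos_nonneg)
  let ?m = "of_real (t / c) * cnj w * y" and ?E = "exp (- t / c * (cmod y)\<^sup>2)"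
  have "has_bochner_integral lborel (\<lambda>x. (?m + x) * exp (- c * (cmod (?m + x))\<^sup>2) - ?m * exp (- c * (cmod (?m + x))\<^sup>2))
     (0 - ?m * of_real (pi / c))"
    by (intro has_bochner_integral_diff has_bochner_integral_mult_right has_bochner_integral_of_real
        has_bochner_integral_lborel_translate[where f = "\<lambda>x. exp (- c * (cmod x)\<^sup>2)"] gaussian_integral_complex_0 c
        has_bochner_integral_lborel_translate[where f = "\<lambda>x. x * exp (- c * (cmod x)\<^sup>2)"] gaussian_integral_complex_1)
  then have "has_bochner_integral lborel (\<lambda>x. of_real ?E * (x * exp (- c * (cmod (?m + x))\<^sup>2)))
     (of_real ?E * - (?m * of_real (pi / c)))"
    by (intro has_bochner_integral_mult_right) (simp add: ring_distribs)
  moreover have eq: "exp (- (cmod x)\<^sup>2) *\<^sub>R exp (- t * (cmod (y + w * x))\<^sup>2) *\<^sub>R x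
      = of_real ?E * (x * exp (- c * (cmod (?m + x))\<^sup>2))" for x
    unfolding scaleR_scaleR exp_gaussian_complete_square[OF t, where w = w and y = y, folded c_def]
    by (simp add: scaleR_conv_of_real)
  moreover have "of_real ?E * - (?m * of_real (pi / c)) = pi *\<^sub>R - (of_real (t * ?E / c\<^sup>2) * cnj w * y)"
    by (simp add: scaleR_conv_of_real power2_eq_square)
  ultimately have "has_bochner_integral complex_gaussian (\<lambda>x. exp (- t * (cmod (y + w * x))\<^sup>2) *\<^sub>R x)
      (- (of_real (t * ?E / c\<^sup>2) * cnj w * y))"
    by (intro has_bochner_integral_complex_gaussian) (simp_all only: eq, measurable)
  then show ?thesis by (rule has_bochner_integral_integral_eq)
qed

text \<open>The value is the total mass 1 / c times the variance 1 / c. Only the centred case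
  occurs, because this moment is taken in the coordinate that is integrated last; t = 0 gives the
  plain second moment.\<close>

lemma complex_gaussian_tilted_2:
  fixes w :: complex and t :: real
  assumes t: "t \<ge> 0"
  defines "c \<equiv> 1 + t * (cmod w)\<^sup>2"
  shows "has_bochner_integral complex_gaussian (\<lambda>x. (cmod x)\<^sup>2 * exp (- t * (cmod (w * x))\<^sup>2)) (1 / c\<^sup>2)"
proof -
  have c: "c > 0" using t by (simp add: c_def add_pos_nonneg)
  have eq: "exp (- (cmod x)\<^sup>2) *\<^sub>R ((cmod x)\<^sup>2 * exp (- t * (cmod (w * x))\<^sup>2)) =
      (cmod x)\<^sup>2 * exp (- c * (cmod x)\<^sup>2)" for x
    using exp_gaussian_complete_square[OF t, where y = 0 and w = w and x = x, folded c_def] by simp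
  show ?thesis
    by (intro has_bochner_integral_complex_gaussian)
       (unfold eq, measurable, use gaussian_integral_complex_2[OF c] in simp)
qed

lemma prob_space_complex_gaussian: "prob_space complex_gaussian"
proof
  have "(\<integral>\<^sup>+z. ennreal (exp (- (cmod z)\<^sup>2)) \<partial>lborel) = ennreal pi"
    using gaussian_integral_complex_0[of 1] by (subst nn_integral_eq_integral) (auto simp: has_bochner_integral_iff)
  then show "emeasure complex_gaussian (space complex_gaussian) = 1"
    by (simp add: complex_gaussian_def emeasure_density divide_ennreal[symmetric] nn_integral_divide del: divide_ennreal)
qed

text \<open>Rescaling both real variables by sqrt 2 turns the joint density exp (-(x^2 + y^2) / 2) /
  (2 \<pi>) into exp (-|z|^2) / \<pi>; the Jacobian 2 of the rescaling accounts for the change of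
  constant.\<close>

lemma distr_std_complex_gaussian:
  assumes "prob_space M" and X: "std_complex_gaussian M X"
  shows "X \<in> borel_measurable M" and "distr M borel X = complex_gaussian"
proof -
  interpret prob_space M by fact
  let ?f = "std_normal_density"
  obtain R I where R: "distributed M lborel R (\<lambda>x. ennreal (?f x))"
    and I: "distributed M lborel I (\<lambda>x. ennreal (?f x))"
    and ind: "indep_var borel R borel I"
    and X: "\<And>\<omega>. \<omega> \<in> space M \<Longrightarrow> X \<omega> = (1 / complex_of_real (sqrt 2)) * (complex_of_real (R \<omega>) + \<i> * complex_of_real (I \<omega>))"
    using X unfolding std_complex_gaussian_def by blast
  have [measurable]: "R \<in> borel_measurable M" "I \<in> borel_measurable M"
    using distributed_measurable[OF R] distributed_measurable[OF I] by simp_all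
  have "distr M lborel R \<Otimes>\<^sub>M distr M lborel I = distr M borel R \<Otimes>\<^sub>M distr M borel I"
    by (intro arg_cong2[where f = pair_measure] distr_cong) auto
  also have "\<dots> = distr M (borel \<Otimes>\<^sub>M borel) (\<lambda>\<omega>. (R \<omega>, I \<omega>))"
    using ind by (simp add: indep_var_distribution_eq)
  also have "\<dots> = distr M (lborel \<Otimes>\<^sub>M lborel) (\<lambda>\<omega>. (R \<omega>, I \<omega>))"
    by (intro distr_cong sets_pair_measure_cong) auto
  finally have joint: "distributed M (lborel \<Otimes>\<^sub>M lborel) (\<lambda>\<omega>. (R \<omega>, I \<omega>)) (\<lambda>(x, y). ennreal (?f x) * ennreal (?f y))"
    by (intro distributed_joint_indep' R I) (auto intro: lborel.sigma_finite_measure_axioms)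
  define T where "T x y = Complex (x / sqrt 2) (y / sqrt 2)" for x y
  have XT: "X \<omega> = T (R \<omega>) (I \<omega>)" if "\<omega> \<in> space M" for \<omega>
  proof -
    have "1 / complex_of_real (sqrt 2) = complex_of_real (1 / sqrt 2)" by simp
    then show ?thesis unfolding X[OF that] T_def by (auto intro!: complex_eqI simp del: of_real_divide)
  qed
  have mT: "(\<lambda>p. T (fst p) (snd p)) \<in> borel_measurable borel"
  proof -
    have "(\<lambda>p :: real \<times> real. complex_of_real (fst p / sqrt 2) + \<i> * complex_of_real (snd p / sqrt 2)) \<in> borel_measurable borel"
      by (intro borel_measurable_continuous_onI continuous_intros) auto
    then show ?thesis by (simp add: T_def Complex_eq)
  qed
  then have [measurable]: "(\<lambda>p. T (fst p) (snd p)) \<in> borel_measurable (lborel \<Otimes>\<^sub>M lborel)"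
    by (simp add: lborel_prod)
  have mT2 [measurable]: "(\<lambda>y. T (f y) (g y)) \<in> borel_measurable N"
    if [measurable]: "f \<in> borel_measurable N" "g \<in> borel_measurable N" for f g and N :: "'z measure"
    using measurable_compose[OF borel_measurable_Pair[OF that] mT] by simp
  show Xm [measurable]: "X \<in> borel_measurable M"
    by (subst measurable_cong[OF XT]) auto
  show "distr M borel X = complex_gaussian"
  proof (rule measure_eqI)
    fix B assume "B \<in> sets (distr M borel X)"
    then have [measurable]: "B \<in> sets borel" by simp
    have cm: "(\<lambda>p. Complex (f p) (g p)) \<in> borel_measurable N"
      if [measurable]: "f \<in> borel_measurable N" "g \<in> borel_measurable N" for f g and N :: "'z measure"
      by (simp add: Complex_eq)
    note cm [measurable]
    have "emeasure (distr M borel X) B = (\<integral>\<^sup>+\<omega>. indicator B (X \<omega>) \<partial>M)"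
      by (subst nn_integral_indicator[symmetric], simp, subst nn_integral_distr) auto
    also have "\<dots> = (\<integral>\<^sup>+\<omega>. indicator B (T (fst (R \<omega>, I \<omega>)) (snd (R \<omega>, I \<omega>))) \<partial>M)"
      by (intro nn_integral_cong) (simp add: XT)
    also have "\<dots> = (\<integral>\<^sup>+p. (case p of (x, y) \<Rightarrow> ennreal (?f x) * ennreal (?f y)) * indicator B (T (fst p) (snd p)) \<partial>(lborel \<Otimes>\<^sub>M lborel))"
      by (rule distributed_nn_integral[OF joint, symmetric]) measurable
    also have "\<dots> = (\<integral>\<^sup>+x. \<integral>\<^sup>+y. ennreal (?f x) * ennreal (?f y) * indicator B (T x y) \<partial>lborel \<partial>lborel)"
      by (subst lborel.nn_integral_fst[symmetric]) (auto simp: split_beta')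
    also have "\<dots> = (\<integral>\<^sup>+x. ennreal (sqrt 2) * (\<integral>\<^sup>+y. ennreal (?f x) * ennreal (?f (sqrt 2 * y)) * indicator B (T x (sqrt 2 * y)) \<partial>lborel) \<partial>lborel)"
      by (intro nn_integral_cong, subst nn_integral_real_affine[of _ "sqrt 2" 0]) auto
    also have "\<dots> = ennreal (sqrt 2) * (\<integral>\<^sup>+x. ennreal (sqrt 2) * (\<integral>\<^sup>+y. ennreal (?f (sqrt 2 * x)) * ennreal (?f (sqrt 2 * y)) * indicator B (T (sqrt 2 * x) (sqrt 2 * y)) \<partial>lborel) \<partial>lborel)"
      by (subst nn_integral_real_affine[of _ "sqrt 2" 0]) auto
    also have "\<dots> = (\<integral>\<^sup>+x. \<integral>\<^sup>+y. ennreal (exp (- (cmod (Complex x y))\<^sup>2) / pi) * indicator B (Complex x y) \<partial>lborel \<partial>lborel)"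
    proof -
      have "ennreal (sqrt 2) * (ennreal (sqrt 2) * (ennreal (?f (sqrt 2 * x)) * ennreal (?f (sqrt 2 * y)))) =
          ennreal (exp (- (cmod (Complex x y))\<^sup>2) / pi)" for x y
      proof -
        have "sqrt 2 * (sqrt 2 * (?f (sqrt 2 * x) * ?f (sqrt 2 * y))) = exp (- (cmod (Complex x y))\<^sup>2) / pi"
          by (simp add: std_normal_density_def power_mult_distrib cmod_power2 exp_minus exp_diff real_sqrt_mult field_simps exp_add)
        then show ?thesis by (simp flip: ennreal_mult)
      qed
      then show ?thesis
        by (simp add: T_def nn_integral_cmult[symmetric] mult.assoc[symmetric] cong: nn_integral_cong)
    qed
    also have "\<dots> = emeasure complex_gaussian B"
      by (simp add: complex_gaussian_def emeasure_density nn_integral_lborel_complex)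
    finally show "emeasure (distr M borel X) B = emeasure complex_gaussian B" .
  qed simp
qed

section \<open>Weighted moments of products of complex Gaussians\<close>

lemma product_prob_space_complex_gaussian: "product_prob_space (\<lambda>_. complex_gaussian)"
  using prob_space_complex_gaussian
  by (simp add: product_prob_space_def product_prob_space_axioms_def product_sigma_finite_def prob_space_imp_sigma_finite)

lemma borel_measurable_cnj [measurable (raw)]:
  "f \<in> borel_measurable M \<Longrightarrow> (\<lambda>x. cnj (f x)) \<in> borel_measurable M"
  by (rule measurable_compose[of f M borel cnj borel]) (auto intro!: borel_measurable_continuous_onI continuous_intros)

lemma measurable_component_complex_gaussian:
  assumes "i \<in> J"
  shows "(\<lambda>x. x i) \<in> borel_measurable (PiM J (\<lambda>_. complex_gaussian))"
  using measurable_component_singleton[OF assms, of "\<lambda>_. complex_gaussian"]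
  by (simp only: measurable_cong_sets[OF refl sets_complex_gaussian])

text \<open>The weighted sum is a complex Gaussian of variance W, the sum of the |w b|^2, so this is
  the formula for one variable with |w|^2 replaced by W. The shift \<open>s\<close> stands for
  coordinates that are kept fixed; the induction varies \<open>t\<close>, which every integration
  changes.\<close>

lemma integral_PiM_gaussian_tilted:
  fixes w :: "'i \<Rightarrow> complex" and s :: complex and t :: real
  assumes "finite B" and "t \<ge> 0"
  shows "(\<integral>x. exp (- t * (cmod (s + (\<Sum>b\<in>B. w b * x b)))\<^sup>2) \<partial>PiM B (\<lambda>_. complex_gaussian)) =
    exp (- t / (1 + t * (\<Sum>b\<in>B. (cmod (w b))\<^sup>2)) * (cmod s)\<^sup>2) / (1 + t * (\<Sum>b\<in>B. (cmod (w b))\<^sup>2))"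
  using assms
proof (induction B arbitrary: s t rule: finite_induct)
  case empty
  interpret product_prob_space "\<lambda>_::'i. complex_gaussian" by (rule product_prob_space_complex_gaussian)
  show ?case by (simp add: PiM_empty lebesgue_integral_count_space_finite)
next
  case (insert i B)
  interpret product_prob_space "\<lambda>_::'i. complex_gaussian" by (rule product_prob_space_complex_gaussian)
  let ?P = "PiM B (\<lambda>_. complex_gaussian)"
  define c where "c = 1 + t * (cmod (w i))\<^sup>2"
  have c: "c > 0" using insert.prems by (simp add: c_def add_pos_nonneg)
  let ?W = "\<Sum>b\<in>B. (cmod (w b))\<^sup>2"
  have W: "?W \<ge> 0" by (simp add: sum_nonneg)
  have int: "integrable (PiM (insert i B) (\<lambda>_. complex_gaussian))
      (\<lambda>x. exp (- t * (cmod (s + (\<Sum>b\<in>insert i B. w b * x b)))\<^sup>2))"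
    using insert.prems by (intro prob_space.finite_measure[THEN finite_measure.integrable_const_bound, where B = 1]
      prob_space_PiM prob_space_complex_gaussian) auto
  have "(\<integral>x. exp (- t * (cmod (s + (\<Sum>b\<in>insert i B. w b * x b)))\<^sup>2) \<partial>PiM (insert i B) (\<lambda>_. complex_gaussian)) =
      (\<integral>x. \<integral>y. exp (- t * (cmod (s + (\<Sum>b\<in>insert i B. w b * (x(i := y)) b)))\<^sup>2) \<partial>complex_gaussian \<partial>?P)"
    using insert.hyps int by (rule product_integral_insert)
  also have "\<dots> = (\<integral>x. exp (- (t / c) * (cmod (s + (\<Sum>b\<in>B. w b * x b)))\<^sup>2) / c \<partial>?P)"
  proof (rule Bochner_Integration.integral_cong)
    fix x :: "'i \<Rightarrow> complex"
    have "s + (\<Sum>b\<in>insert i B. w b * (x(i := y)) b) = (s + (\<Sum>b\<in>B. w b * x b)) + w i * y" for y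
    proof -
      have "(\<Sum>b\<in>B. w b * (x(i := y)) b) = (\<Sum>b\<in>B. w b * x b)"
        using insert.hyps by (intro sum.cong) auto
      then show ?thesis using insert.hyps by simp
    qed
    then show "(\<integral>y. exp (- t * (cmod (s + (\<Sum>b\<in>insert i B. w b * (x(i := y)) b)))\<^sup>2) \<partial>complex_gaussian) =
        exp (- (t / c) * (cmod (s + (\<Sum>b\<in>B. w b * x b)))\<^sup>2) / c"
      using complex_gaussian_tilted_0[OF insert.prems, of "s + (\<Sum>b\<in>B. w b * x b)" "w i"]
      by (simp only: c_def minus_divide_left)
  qed simp
  also have "\<dots> = exp (- (t / c) / (1 + t / c * ?W) * (cmod s)\<^sup>2) / (1 + t / c * ?W) / c"
    using insert.IH[of "t / c" s] insert.prems c by simp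
  also have "\<dots> = exp (- t / (1 + t * (\<Sum>b\<in>insert i B. (cmod (w b))\<^sup>2)) * (cmod s)\<^sup>2) / (1 + t * (\<Sum>b\<in>insert i B. (cmod (w b))\<^sup>2))"
    (is "exp (_ / ?X * _) / _ / c = exp (_ / ?Y * _) / _")
  proof -
    \<comment> \<open>The normalising constants telescope: with c = 1 + t |w i|^2, the product of c
      and 1 + (t / c) W is 1 + t (|w i|^2 + W).\<close>
    have XY: "?X * c = ?Y"
      using c insert.hyps by (simp add: field_simps) (simp add: c_def field_simps)
    have "- (t / c) / ?X = - t / ?Y" unfolding XY[symmetric] by (simp add: mult.commute)
    moreover have "r / ?X / c = r / ?Y" for r unfolding XY[symmetric] by simp
    ultimately show ?thesis by (simp only:)
  qed
  finally show ?case .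
qed

text \<open>Since the weight is at most 1 in modulus, |x a|^2 + |x b|^2 is an integrable
  bound.\<close>

lemma integrable_PiM_gaussian_product:
  fixes f :: "('i \<Rightarrow> complex) \<Rightarrow> real"
  assumes B: "finite B" "a \<in> B" "b \<in> B"
    and [measurable]: "f \<in> borel_measurable (PiM B (\<lambda>_. complex_gaussian))"
    and f: "\<And>x. \<bar>f x\<bar> \<le> 1"
  shows "integrable (PiM B (\<lambda>_. complex_gaussian)) (\<lambda>x. f x *\<^sub>R (x a * cnj (x b)))"
proof -
  interpret product_prob_space "\<lambda>_::'i. complex_gaussian" by (rule product_prob_space_complex_gaussian)
  have sq: "integrable (PiM B (\<lambda>_. complex_gaussian)) (\<lambda>x. (cmod (x i))\<^sup>2)" if "i \<in> B" for i
  proof -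
    have "integrable complex_gaussian (\<lambda>z. (cmod z)\<^sup>2)"
      using complex_gaussian_tilted_2[of 0] by (simp add: has_bochner_integral_iff)
    then show ?thesis
      by (intro integrable_distr[where f = "\<lambda>z. (cmod z)\<^sup>2", of "\<lambda>x. x i" _ complex_gaussian])
         (use that product_prob_space.PiM_component[OF product_prob_space_complex_gaussian that] in auto)
  qed
  have [measurable]: "(\<lambda>x. x a) \<in> borel_measurable (PiM B (\<lambda>_. complex_gaussian))"
      "(\<lambda>x. x b) \<in> borel_measurable (PiM B (\<lambda>_. complex_gaussian))"
    using B by (auto intro: measurable_component_complex_gaussian)
  show ?thesis
  proof (rule Bochner_Integration.integrable_bound)
    show "integrable (PiM B (\<lambda>_. complex_gaussian)) (\<lambda>x. (cmod (x a))\<^sup>2 + (cmod (x b))\<^sup>2)"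
      using sq B by auto
    show "AE x in PiM B (\<lambda>_. complex_gaussian). norm (f x *\<^sub>R (x a * cnj (x b))) \<le> norm ((cmod (x a))\<^sup>2 + (cmod (x b))\<^sup>2)"
    proof (rule AE_I2)
      fix x :: "'i \<Rightarrow> complex"
      have "\<bar>f x\<bar> * (cmod (x a) * cmod (x b)) \<le> 1 * (cmod (x a) * cmod (x b))"
        by (rule mult_right_mono[OF f]) simp
      also have "\<dots> \<le> (cmod (x a))\<^sup>2 + (cmod (x b))\<^sup>2"
      proof -
        have "0 \<le> cmod (x a) * cmod (x b)" by simp
        with sum_squares_bound[of "cmod (x a)" "cmod (x b)"] show ?thesis by linarith
      qed
      finally show "norm (f x *\<^sub>R (x a * cnj (x b))) \<le> norm ((cmod (x a))\<^sup>2 + (cmod (x b))\<^sup>2)"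
        by (simp add: norm_mult)
    qed
  qed measurable
qed

lemma integral_PiM_singleton_complex_gaussian:
  fixes f :: "complex \<Rightarrow> 'b::{banach, second_countable_topology}"
  assumes "f \<in> borel_measurable borel"
  shows "(\<integral>x. f (x a) \<partial>PiM {a} (\<lambda>_. complex_gaussian)) = (\<integral>x. f x \<partial>complex_gaussian)"
proof -
  interpret product_prob_space "\<lambda>_. complex_gaussian" by (rule product_prob_space_complex_gaussian)
  show ?thesis using assms by (intro product_integral_singleton) simp
qed

text \<open>Up to normalisation, the weight turns the product measure into the complex Gaussian with precision
  matrix \<open>1 + w w*\<close>, whose covariance matrix is the inverse of that matrix.\<close>

lemma integral_PiM_gaussian_cov:
  fixes w :: "'i \<Rightarrow> complex"
  assumes B: "finite B" "a \<in> B" "b \<in> B"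
  defines "S \<equiv> 1 + (\<Sum>b\<in>B. (cmod (w b))\<^sup>2)"
  shows "(\<integral>x. exp (- (cmod (\<Sum>d\<in>B. w d * x d))\<^sup>2) *\<^sub>R (x a * cnj (x b)) \<partial>PiM B (\<lambda>_. complex_gaussian)) =
    ((if a = b then 1 else 0) - cnj (w a) * w b / S) / S"
proof -
  interpret product_prob_space "\<lambda>_::'i. complex_gaussian" by (rule product_prob_space_complex_gaussian)
  let ?G = "\<lambda>_::'i. complex_gaussian"
  note measurable_component_complex_gaussian [measurable]
  have nsq: "(complex_of_real (cmod z))\<^sup>2 = z * cnj z" for z
    using complex_norm_square[of z] by simp
  \<comment> \<open>All coordinates except \<open>a\<close> and \<open>b\<close> are integrated out
    at once; a weight with parameter 1 / C in at most two variables remains.\<close>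
  define K where "K = B - {a, b}"
  define I where "I = {a, b}"
  have BIK: "B = I \<union> K" "I \<inter> K = {}" "finite I" "finite K" using B by (auto simp: K_def I_def)
  define C where "C = 1 + (\<Sum>d\<in>K. (cmod (w d))\<^sup>2)"
  have C: "C > 0" by (simp add: C_def add_pos_nonneg sum_nonneg)
  have SC: "S = C + (\<Sum>d\<in>I. (cmod (w d))\<^sup>2)"
    unfolding S_def C_def BIK(1) using BIK by (subst sum.union_disjoint) auto
  have S: "S > 0" using C by (simp add: SC add_pos_nonneg sum_nonneg)
  let ?f = "\<lambda>x. exp (- (cmod (\<Sum>d\<in>B. w d * x d))\<^sup>2) *\<^sub>R (x a * cnj (x b))"
  have int: "integrable (PiM B ?G) ?f"
    using B by (intro integrable_PiM_gaussian_product) auto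
  have "integral\<^sup>L (PiM B ?G) ?f = (\<integral>x. (\<integral>y. ?f (merge I K (x, y)) \<partial>PiM K ?G) \<partial>PiM I ?G)"
    using int unfolding BIK(1) by (intro product_integral_fold BIK)
  also have "\<dots> = (\<integral>x. (exp (- (1 / C) * (cmod (\<Sum>d\<in>I. w d * x d))\<^sup>2) / C) *\<^sub>R (x a * cnj (x b)) \<partial>PiM I ?G)"
  proof (rule Bochner_Integration.integral_cong)
    fix x :: "'i \<Rightarrow> complex"
    have "(\<Sum>d\<in>B. w d * merge I K (x, y) d) = (\<Sum>d\<in>I. w d * x d) + (\<Sum>d\<in>K. w d * y d)" for y
      unfolding BIK(1) using BIK by (subst sum.union_disjoint) (auto intro!: sum.cong simp: merge_def)
    moreover have "merge I K (x, y) a = x a" "merge I K (x, y) b = x b" for y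
      by (auto simp: merge_def I_def)
    ultimately have "(\<integral>y. ?f (merge I K (x, y)) \<partial>PiM K ?G) =
        (\<integral>y. exp (- 1 * (cmod ((\<Sum>d\<in>I. w d * x d) + (\<Sum>d\<in>K. w d * y d)))\<^sup>2) *\<^sub>R (x a * cnj (x b)) \<partial>PiM K ?G)"
      by simp
    also have "\<dots> = (\<integral>y. exp (- 1 * (cmod ((\<Sum>d\<in>I. w d * x d) + (\<Sum>d\<in>K. w d * y d)))\<^sup>2) \<partial>PiM K ?G) *\<^sub>R (x a * cnj (x b))"
      by (intro integral_scaleR_left prob_space.finite_measure[THEN finite_measure.integrable_const_bound, where B = 1]
          prob_space_PiM prob_space_complex_gaussian) auto
    finally have "(\<integral>y. ?f (merge I K (x, y)) \<partial>PiM K ?G) =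
        (\<integral>y. exp (- 1 * (cmod ((\<Sum>d\<in>I. w d * x d) + (\<Sum>d\<in>K. w d * y d)))\<^sup>2) \<partial>PiM K ?G) *\<^sub>R (x a * cnj (x b))" .
    then show "(\<integral>y. ?f (merge I K (x, y)) \<partial>PiM K ?G) =
        (exp (- (1 / C) * (cmod (\<Sum>d\<in>I. w d * x d))\<^sup>2) / C) *\<^sub>R (x a * cnj (x b))"
      by (subst (asm) integral_PiM_gaussian_tilted[OF BIK(4)]) (simp_all add: C_def)
  qed simp
  \<comment> \<open>The claimed value is the total mass 1 / S times an entry of the Sherman-Morrison
    inverse of a rank-one perturbation of the identity. With one or two variables left it is
    computed directly.\<close>
  also have "\<dots> = ((if a = b then 1 else 0) - cnj (w a) * w b / S) / S"
  proof (cases "a = b")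
    case True
    let ?c = "1 + 1 / C * (cmod (w a))\<^sup>2"
    have c: "C * ?c = S" using C True by (simp add: SC I_def field_simps)
    have "(\<integral>x. (exp (- (1 / C) * (cmod (\<Sum>d\<in>I. w d * x d))\<^sup>2) / C) *\<^sub>R (x a * cnj (x b)) \<partial>PiM I ?G) =
        (\<integral>x. (exp (- (1 / C) * (cmod (w a * x))\<^sup>2) / C) *\<^sub>R (x * cnj x) \<partial>complex_gaussian)"
    proof -
      have "I = {a}" using True by (simp add: I_def)
      then have "(\<integral>x. (exp (- (1 / C) * (cmod (\<Sum>d\<in>I. w d * x d))\<^sup>2) / C) *\<^sub>R (x a * cnj (x b)) \<partial>PiM I ?G) =
        (\<integral>x. (exp (- (1 / C) * (cmod (w a * x a))\<^sup>2) / C) *\<^sub>R (x a * cnj (x a)) \<partial>PiM {a} ?G)"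
        using True by (simp only: sum.insert[of "{}"] finite.emptyI empty_iff not_False_eq_True sum.empty add_0_right)
      also have "\<dots> = (\<integral>x. (exp (- (1 / C) * (cmod (w a * x))\<^sup>2) / C) *\<^sub>R (x * cnj x) \<partial>complex_gaussian)"
        by (rule integral_PiM_singleton_complex_gaussian[of "\<lambda>x. (exp (- (1 / C) * (cmod (w a * x))\<^sup>2) / C) *\<^sub>R (x * cnj x)"])
           (intro borel_measurable_continuous_onI continuous_intros, use C in auto)
      finally show ?thesis .
    qed
    also have "\<dots> = (\<integral>x. complex_of_real (1 / C * ((cmod x)\<^sup>2 * exp (- (1 / C) * (cmod (w a * x))\<^sup>2))) \<partial>complex_gaussian)"
      by (intro Bochner_Integration.integral_cong)
         (simp_all add: scaleR_conv_of_real nsq)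
    also have "\<dots> = complex_of_real (1 / C * (1 / ?c\<^sup>2))"
      unfolding integral_complex_of_real using complex_gaussian_tilted_2[of "1 / C" "w a"] C
      by (simp add: has_bochner_integral_iff)
    also have "1 / C * (1 / ?c\<^sup>2) = (1 - (cmod (w a))\<^sup>2 / S) / S"
    proof -
      have "1 / C * (1 / ?c\<^sup>2) = C / (C * ?c)\<^sup>2" using C by (simp add: power2_eq_square)
      also have "\<dots> = C / S\<^sup>2" by (simp only: c)
      also have "\<dots> = (S - (cmod (w a))\<^sup>2) / S\<^sup>2" using True by (simp add: SC I_def)
      also have "\<dots> = (1 - (cmod (w a))\<^sup>2 / S) / S" using S by (simp add: field_simps power2_eq_square)
      finally show ?thesis .
    qed
    finally show ?thesis using True
      by (simp add: nsq mult.commute)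
  next
    case False
    let ?c = "1 + 1 / C * (cmod (w a))\<^sup>2"
    \<comment> \<open>\<open>?t\<close> is the parameter left for the coordinate \<open>b\<close>
      once \<open>a\<close> has been integrated; the constants \<open>C\<close>, \<open>?c\<close>
      and \<open>?d\<close> of the three stages multiply to \<open>S\<close>.\<close>
    let ?t = "1 / C / ?c"
    let ?d = "1 + ?t * (cmod (w b))\<^sup>2"
    have c0: "?c > 0" using C by (simp add: add_pos_nonneg)
    have d: "C * (?c * ?d) = S"
    proof -
      have "k * (1 + r / k * q) = k + r * q" if "k > 0" for k r q :: real
        using that by (simp add: distrib_left)
      from this[OF c0] have "?c * ?d = ?c + 1 / C * (cmod (w b))\<^sup>2" .
      then show ?thesis using C False by (simp add: SC I_def distrib_left)
    qed
    let ?g = "\<lambda>x. (exp (- (1 / C) * (cmod (\<Sum>d\<in>{a, b}. w d * x d))\<^sup>2) / C) *\<^sub>R (x a * cnj (x b))"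
    have "integrable (PiM I ?G) (\<lambda>x. (1 / C) *\<^sub>R (exp (- (1 / C) * (cmod (\<Sum>d\<in>I. w d * x d))\<^sup>2) *\<^sub>R (x a * cnj (x b))))"
      using C by (intro integrable_scaleR_right integrable_PiM_gaussian_product) (auto simp: I_def)
    then have intg: "integrable (PiM {a, b} ?G) ?g" by (simp add: I_def)
    \<comment> \<open>The coordinate \<open>a\<close> comes first: its tilted first moment is linear
      in \<open>x b\<close>, so the integral over \<open>b\<close> becomes a centred second
      moment.\<close>
    have "(\<integral>x. ?g x \<partial>PiM {a, b} ?G) = (\<integral>x. (\<integral>y. ?g (x(a := y)) \<partial>complex_gaussian) \<partial>PiM {b} ?G)"
      using False intg by (intro product_integral_insert) auto
    also have "\<dots> = (\<integral>x. (\<integral>y. (exp (- (1 / C) * (cmod (w b * x b + w a * y))\<^sup>2) *\<^sub>R y) * (cnj (x b) / C) \<partial>complex_gaussian) \<partial>PiM {b} ?G)"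
      using False by (intro Bochner_Integration.integral_cong) (auto simp: scaleR_conv_of_real add.commute)
    also have "\<dots> = (\<integral>x. (\<integral>y. (exp (- (1 / C) * (cmod (w b * x + w a * y))\<^sup>2) *\<^sub>R y) * (cnj x / C) \<partial>complex_gaussian) \<partial>complex_gaussian)"
      by (rule integral_PiM_singleton_complex_gaussian[of "\<lambda>x. \<integral>y. (exp (- (1 / C) * (cmod (w b * x + w a * y))\<^sup>2) *\<^sub>R y) * (cnj x / C) \<partial>complex_gaussian"])
        (intro sigma_finite_measure.borel_measurable_lebesgue_integral sigma_finite_measures, measurable)
    also have "\<dots> = (\<integral>x. - (of_real (1 / C * exp (- (1 / C) / ?c * (cmod (w b * x))\<^sup>2) / ?c\<^sup>2) * cnj (w a) * (w b * x)) * (cnj x / C) \<partial>complex_gaussian)"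
      using C by (subst integral_mult_left_zero, subst complex_gaussian_tilted_1) auto
    also have "\<dots> = (\<integral>x. (- (cnj (w a) * w b) / (C * ?c)\<^sup>2) * complex_of_real ((cmod x)\<^sup>2 * exp (- ?t * (cmod (w b * x))\<^sup>2)) \<partial>complex_gaussian)"
      by (intro Bochner_Integration.integral_cong)
         (simp_all add: nsq power_mult_distrib power2_eq_square[of "complex_of_real C"] mult_ac)
    also have "\<dots> = (- (cnj (w a) * w b) / (C * ?c)\<^sup>2) * complex_of_real (1 / ?d\<^sup>2)"
    proof -
      have "0 \<le> ?t" using C c0 by simp
      then have "(\<integral>x. (cmod x)\<^sup>2 * exp (- ?t * (cmod (w b * x))\<^sup>2) \<partial>complex_gaussian) = 1 / ?d\<^sup>2"
        by (rule has_bochner_integral_integral_eq[OF complex_gaussian_tilted_2])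
      then show ?thesis by (simp only: integral_mult_right_zero integral_complex_of_real)
    qed
    also have "\<dots> = - (cnj (w a) * w b) / complex_of_real ((C * (?c * ?d))\<^sup>2)"
      by (simp add: power_mult_distrib)
    also have "\<dots> = - (cnj (w a) * w b) / complex_of_real (S\<^sup>2)" by (simp only: d)
    finally show ?thesis using False by (simp add: I_def power2_eq_square)
  qed
  finally show ?thesis .
qed

subsection \<open>The complex Hessian\<close>

definition gibbs :: "(complex^'n) set \<Rightarrow> complex^'n \<Rightarrow> complex^'n \<Rightarrow> real" where
  "gibbs A z a = exp (2 * Re (herm a z)) / (\<Sum>b\<in>A. exp (2 * Re (herm b z)))"

lemma herm_add_axis: "herm a (z + t *\<^sub>R axis j c) = herm a z + of_real t * (cnj (a $ j) * c)"
proof -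
  have "(\<Sum>i\<in>UNIV. cnj (a $ i) * (t *\<^sub>R axis j c $ i)) = of_real t * (cnj (a $ j) * c)"
    by (simp add: axis_def scaleR_conv_of_real if_distrib[of "\<lambda>x. _ * x"] mult.left_commute cong: if_cong)
  then show ?thesis
    unfolding herm_def vector_add_component distrib_left sum.distrib by simp
qed

lemma has_derivative_exp_herm_line:
  "((\<lambda>t. exp (2 * Re (herm a (z + t *\<^sub>R axis j c)))) has_real_derivative
     2 * Re (cnj (a $ j) * c) * exp (2 * Re (herm a z))) (at 0)"
  unfolding herm_add_axis
  by (auto intro!: derivative_eq_intros simp: Re_divide)

lemma sum_exp_pos:
  assumes "finite A" "A \<noteq> {}"
  shows "(\<Sum>b\<in>A. exp (2 * Re (herm b z))) > 0"
  using assms by (intro sum_pos) auto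

lemma sum_gibbs:
  assumes "finite A" "A \<noteq> {}"
  shows "(\<Sum>a\<in>A. gibbs A z a) = 1"
  using sum_exp_pos[OF assms, of z] by (simp add: gibbs_def sum_divide_distrib[symmetric])

lemma dir_deriv_of_real:
  assumes "((\<lambda>t. f (z + t *\<^sub>R v)) has_real_derivative D) (at 0)"
  shows "dir_deriv v (\<lambda>w. complex_of_real (f w)) z = of_real D"
  unfolding dir_deriv_def
  using has_vector_derivative_of_real[OF assms] by (rule vector_derivative_at)

lemma dir_deriv_Phi:
  assumes "finite A" "A \<noteq> {}"
  shows "dir_deriv (axis j c) (\<lambda>w. complex_of_real (Phi A w)) z =
    of_real (\<Sum>a\<in>A. gibbs A z a * (2 * Re (cnj (a $ j) * c)))"
proof (rule dir_deriv_of_real)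
  have "((\<lambda>t. \<Sum>a\<in>A. exp (2 * Re (herm a (z + t *\<^sub>R axis j c)))) has_real_derivative
      (\<Sum>a\<in>A. 2 * Re (cnj (a $ j) * c) * exp (2 * Re (herm a z)))) (at 0)"
    by (intro DERIV_sum has_derivative_exp_herm_line)
  from DERIV_ln_divide[THEN DERIV_chain2, OF _ this] sum_exp_pos[OF assms, of z]
  have "((\<lambda>t. Phi A (z + t *\<^sub>R axis j c)) has_real_derivative
      1 / (\<Sum>a\<in>A. exp (2 * Re (herm a z))) * (\<Sum>a\<in>A. 2 * Re (cnj (a $ j) * c) * exp (2 * Re (herm a z)))) (at 0)"
    unfolding Phi_def by simp
  then show "((\<lambda>t. Phi A (z + t *\<^sub>R axis j c)) has_real_derivative
      (\<Sum>a\<in>A. gibbs A z a * (2 * Re (cnj (a $ j) * c)))) (at 0)"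
    by (simp add: gibbs_def sum_divide_distrib mult.commute)
qed

text \<open>The exponent 2 Re (a, z) is (a, z) plus its conjugate. The antiholomorphic derivative
  kills the first summand and takes the value \<open>a $ k\<close> on the second, so a Gibbs mean of
  \<open>a $ k\<close> remains.\<close>

lemma wirtinger_bar_Phi:
  assumes "finite A" "A \<noteq> {}"
  shows "wirtinger_bar k (\<lambda>w. complex_of_real (Phi A w)) = (\<lambda>z. \<Sum>a\<in>A. of_real (gibbs A z a) * a $ k)"
proof
  fix z
  have "of_real (gibbs A z a * (2 * Re (cnj (a $ k)))) + \<i> * of_real (gibbs A z a * (2 * Re (cnj (a $ k) * \<i>))) =
      2 * (of_real (gibbs A z a) * a $ k)" for a
    by (simp add: complex_eq_iff)
  then show "wirtinger_bar k (\<lambda>w. complex_of_real (Phi A w)) z = (\<Sum>a\<in>A. of_real (gibbs A z a) * a $ k)"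
    unfolding wirtinger_bar_def dir_deriv_Phi[OF assms] of_real_sum sum_distrib_left sum.distrib[symmetric]
    by (simp add: sum_distrib_left[symmetric])
qed

text \<open>The logarithmic derivative of a Gibbs weight is the derivative of its exponent minus the
  Gibbs mean of such derivatives.\<close>

lemma dir_deriv_gibbs_mean:
  assumes "finite A" "A \<noteq> {}"
  shows "dir_deriv (axis j c) (\<lambda>w. \<Sum>a\<in>A. of_real (gibbs A w a) * f a) z =
    (\<Sum>a\<in>A. of_real (gibbs A z a * (2 * Re (cnj (a $ j) * c) - (\<Sum>b\<in>A. gibbs A z b * (2 * Re (cnj (b $ j) * c))))) * f a)"
proof -
  let ?S = "\<Sum>a\<in>A. exp (2 * Re (herm a z))"
  have S: "?S > 0" by (rule sum_exp_pos[OF assms])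
  have D: "((\<lambda>t. gibbs A (z + t *\<^sub>R axis j c) a) has_real_derivative
      gibbs A z a * (2 * Re (cnj (a $ j) * c) - (\<Sum>b\<in>A. gibbs A z b * (2 * Re (cnj (b $ j) * c))))) (at 0)" for a
  proof -
    have "((\<lambda>t. \<Sum>a\<in>A. exp (2 * Re (herm a (z + t *\<^sub>R axis j c)))) has_real_derivative
      (\<Sum>a\<in>A. 2 * Re (cnj (a $ j) * c) * exp (2 * Re (herm a z)))) (at 0)" (is "(_ has_real_derivative ?S') _")
      by (intro DERIV_sum has_derivative_exp_herm_line)
    from DERIV_divide[OF has_derivative_exp_herm_line[of a] this] S
    have "((\<lambda>t. gibbs A (z + t *\<^sub>R axis j c) a) has_real_derivative
      (2 * Re (cnj (a $ j) * c) * exp (2 * Re (herm a z)) * ?S - exp (2 * Re (herm a z)) * ?S') / (?S * ?S)) (at 0)"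
      unfolding gibbs_def by simp
    moreover have "(2 * Re (cnj (a $ j) * c) * exp (2 * Re (herm a z)) * ?S - exp (2 * Re (herm a z)) * ?S') / (?S * ?S) =
      gibbs A z a * (2 * Re (cnj (a $ j) * c) - (\<Sum>b\<in>A. gibbs A z b * (2 * Re (cnj (b $ j) * c))))"
    proof -
      have "(\<Sum>b\<in>A. gibbs A z b * (2 * Re (cnj (b $ j) * c))) = ?S' / ?S"
        by (simp add: gibbs_def sum_divide_distrib mult.commute)
      moreover have "(u * e * s - e * q) / (s * s) = e / s * (u - q / s)" if "s > 0" for u e s q :: real
        using that by (simp add: field_simps)
      ultimately show ?thesis using S by (simp only: gibbs_def)
    qed
    ultimately show ?thesis by simp
  qed
  have "((\<lambda>t. \<Sum>a\<in>A. of_real (gibbs A (z + t *\<^sub>R axis j c) a) * f a) has_vector_derivative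
    (\<Sum>a\<in>A. of_real (gibbs A z a * (2 * Re (cnj (a $ j) * c) - (\<Sum>b\<in>A. gibbs A z b * (2 * Re (cnj (b $ j) * c))))) * f a)) (at 0)"
    by (intro has_vector_derivative_sum has_vector_derivative_mult_left has_vector_derivative_of_real D)
  then show ?thesis unfolding dir_deriv_def by (rule vector_derivative_at)
qed

lemma complex_hessian_Phi:
  assumes "finite A" "A \<noteq> {}"
  shows "complex_hessian (Phi A) z $ j $ k =
    (\<Sum>a\<in>A. of_real (gibbs A z a) * (cnj (a $ j) * a $ k)) -
    (\<Sum>a\<in>A. of_real (gibbs A z a) * cnj (a $ j)) * (\<Sum>a\<in>A. of_real (gibbs A z a) * a $ k)"
proof -
  let ?p = "\<lambda>a. complex_of_real (gibbs A z a)"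
  let ?d = "\<lambda>c a. of_real (gibbs A z a * (2 * Re (cnj (a $ j) * c) - (\<Sum>b\<in>A. gibbs A z b * (2 * Re (cnj (b $ j) * c))))) :: complex"
  \<comment> \<open>From the real slopes 2 Re (cnj (a $ j) c) the Wirtinger combination of the
    directions c = 1 and c = \<i> extracts 2 cnj (a $ j).\<close>
  have d: "?d 1 a - \<i> * ?d \<i> a = 2 * (?p a * (cnj (a $ j) - (\<Sum>b\<in>A. ?p b * cnj (b $ j))))" for a
    by (simp add: complex_eq_iff Re_sum Im_sum sum_distrib_left sum_negf algebra_simps)
  have "complex_hessian (Phi A) z $ j $ k = ((\<Sum>a\<in>A. ?d 1 a * a $ k) - \<i> * (\<Sum>a\<in>A. ?d \<i> a * a $ k)) / 2"
    unfolding complex_hessian_def wirtinger_bar_Phi[OF assms]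
    by (simp only: vec_lambda_beta wirtinger_def dir_deriv_gibbs_mean[OF assms])
  also have "\<dots> = (\<Sum>a\<in>A. (?d 1 a - \<i> * ?d \<i> a) * a $ k) / 2"
    by (simp only: sum_distrib_left sum_subtractf[symmetric] left_diff_distrib mult.assoc)
  also have "\<dots> = (\<Sum>a\<in>A. ?p a * (cnj (a $ j) - (\<Sum>b\<in>A. ?p b * cnj (b $ j))) * a $ k)"
    unfolding d by (simp add: mult.assoc sum_distrib_left[symmetric])
  also have "\<dots> = (\<Sum>a\<in>A. ?p a * (cnj (a $ j) * a $ k)) - (\<Sum>b\<in>A. ?p b * cnj (b $ j)) * (\<Sum>a\<in>A. ?p a * a $ k)"
  proof -
    have "p * (c - m) * q = p * (c * q) - m * (p * q)" for p c m q :: complex by (simp add: algebra_simps)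
    then show ?thesis by (simp only: sum_subtractf sum_distrib_left)
  qed
  finally show ?thesis .
qed

subsection \<open>Gaussian vectors\<close>

lemma (in prob_space) distr_restrict_complex_gaussian:
  fixes X :: "'i \<Rightarrow> 'a \<Rightarrow> complex"
  assumes I: "finite I" and ind: "indep_vars (\<lambda>_. borel) X I"
    and X: "\<And>i. i \<in> I \<Longrightarrow> distr M borel (X i) = complex_gaussian"
  shows "distr M (PiM I (\<lambda>_. borel)) (\<lambda>\<omega>. \<lambda>i\<in>I. X i \<omega>) = PiM I (\<lambda>_. complex_gaussian)"
proof (cases "I = {}")
  \<comment> \<open>The empty index set does occur, namely when \<open>A\<close> consists of the
    single frequency \<open>a0\<close>; both laws are then the point mass at the undefined
    function.\<close>
  case True
  have r: "(\<lambda>\<omega>. \<lambda>i\<in>{}. X i \<omega>) = (\<lambda>\<omega>. \<lambda>_. undefined)" by (simp add: fun_eq_iff)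
  show ?thesis
  proof (rule measure_eqI)
    fix A assume "A \<in> sets (distr M (PiM I (\<lambda>_. borel)) (\<lambda>\<omega>. \<lambda>i\<in>I. X i \<omega>))"
    then have "A = {} \<or> A = {\<lambda>_. undefined}" using True by (auto simp: PiM_empty)
    then show "emeasure (distr M (PiM I (\<lambda>_. borel)) (\<lambda>\<omega>. \<lambda>i\<in>I. X i \<omega>)) A = emeasure (PiM I (\<lambda>_. complex_gaussian)) A"
      using True by (auto simp: PiM_empty r emeasure_distr emeasure_space_1 vimage_def)
  qed (auto simp: True PiM_empty)
next
  case False
  have rv: "X i \<in> borel_measurable M" if "i \<in> I" for i
    using ind that by (auto simp: indep_vars_def)
  have "distr M (PiM I (\<lambda>_. borel)) (\<lambda>\<omega>. \<lambda>i\<in>I. X i \<omega>) = PiM I (\<lambda>i. distr M borel (X i))"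
    using ind indep_vars_iff_distr_eq_PiM'[where M' = "\<lambda>_. borel" and X = X, OF False rv] by simp
  also have "\<dots> = PiM I (\<lambda>_. complex_gaussian)"
    using X by (intro PiM_cong) auto
  finally show ?thesis .
qed

lemma borel_measurable_vec_lambda [measurable (raw)]:
  fixes f :: "'n::finite \<Rightarrow> 'w \<Rightarrow> 'a::euclidean_space"
  assumes "\<And>i. f i \<in> borel_measurable M"
  shows "(\<lambda>x. \<chi> i. f i x) \<in> borel_measurable M"
proof (subst borel_measurable_euclidean_space, rule ballI)
  fix b :: "'a^'n" assume "b \<in> Basis"
  then obtain i u where "b = axis i u" by (auto simp: Basis_vec_def)
  then show "(\<lambda>x. (\<chi> i. f i x) \<bullet> b) \<in> borel_measurable M"
    using assms by (simp add: inner_axis)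
qed

lemma borel_measurable_vec_nth [measurable (raw)]:
  fixes f :: "'w \<Rightarrow> 'a::euclidean_space^'n"
  assumes "f \<in> borel_measurable M"
  shows "(\<lambda>x. f x $ i) \<in> borel_measurable M"
  using assms by (rule measurable_compose) (intro borel_measurable_continuous_onI continuous_intros)

lemma distr_PiM_lborel_vec:
  "distr (PiM UNIV (\<lambda>_. lborel)) borel (\<lambda>x. \<chi> k. x k) = (lborel :: ('a::euclidean_space^'n) measure)"
proof (rule sym, rule lborel_eqI)
  interpret product_sigma_finite "\<lambda>_::'n. lborel :: 'a measure"
    by (simp add: product_sigma_finite_def lborel.sigma_finite_measure_axioms)
  have [measurable]: "(\<lambda>x. \<chi> k. x k) \<in> borel_measurable (PiM UNIV (\<lambda>_::'n. lborel :: 'a measure))"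
  proof (rule borel_measurable_vec_lambda)
    show "(\<lambda>x. x k) \<in> borel_measurable (PiM UNIV (\<lambda>_::'n. lborel :: 'a measure))" for k
      using measurable_component_singleton[of k UNIV "\<lambda>_::'n. lborel :: 'a measure"] by simp
  qed
  fix l u :: "'a^'n" assume le: "\<And>b. b \<in> Basis \<Longrightarrow> l \<bullet> b \<le> u \<bullet> b"
  have le': "l $ k \<bullet> b \<le> u $ k \<bullet> b" if "b \<in> Basis" for k b
    using le[of "axis k b"] that by (auto simp: Basis_vec_def inner_axis)
  have "x \<in> (\<lambda>x. \<chi> k. x k) -` box l u \<longleftrightarrow> x \<in> (\<Pi>\<^sub>E k\<in>UNIV. box (l $ k) (u $ k))" for x
    by (auto simp: box_def Basis_vec_def inner_axis PiE_iff)
  then have eq: "(\<lambda>x. \<chi> k. x k) -` box l u = (\<Pi>\<^sub>E k\<in>UNIV. box (l $ k) (u $ k))" by blast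
  have "emeasure (distr (PiM UNIV (\<lambda>_. lborel)) borel (\<lambda>x. \<chi> k. x k)) (box l u) =
      emeasure (PiM UNIV (\<lambda>_::'n. lborel)) (\<Pi>\<^sub>E k\<in>UNIV. box (l $ k) (u $ k))"
    by (subst emeasure_distr) (simp_all add: eq space_PiM)
  also have "\<dots> = (\<Prod>k\<in>UNIV. emeasure lborel (box (l $ k) (u $ k)))"
    by (rule emeasure_PiM) auto
  also have "\<dots> = (\<Prod>k\<in>UNIV. ennreal (\<Prod>b\<in>Basis. (u $ k - l $ k) \<bullet> b))"
    using le' by simp
  also have "\<dots> = ennreal (\<Prod>k\<in>UNIV. \<Prod>b\<in>Basis. (u $ k - l $ k) \<bullet> b)"
    using le' by (intro prod_ennreal prod_nonneg) (auto simp: inner_diff_left)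
  also have "(\<Prod>k\<in>UNIV. \<Prod>b\<in>Basis. (u $ k - l $ k) \<bullet> b) = (\<Prod>b\<in>Basis. (u - l) \<bullet> b)"
  proof -
    have "bij_betw (\<lambda>(k, b). axis k b) (UNIV \<times> Basis) (Basis :: ('a^'n) set)"
      by (auto simp: bij_betw_def inj_on_def Basis_vec_def axis_eq_axis image_iff)
    from prod.reindex_bij_betw[OF this, of "\<lambda>b. (u - l) \<bullet> b"] show ?thesis
      by (simp add: prod.cartesian_product split_beta inner_axis)
  qed
  finally show "emeasure (distr (PiM UNIV (\<lambda>_. lborel)) borel (\<lambda>x. \<chi> k. x k)) (box l u) = (\<Prod>b\<in>Basis. (u - l) \<bullet> b)" .
qed simp

lemma distr_PiM_complex_gaussian_vec:
  "distr (PiM UNIV (\<lambda>_. complex_gaussian)) borel (\<lambda>x. \<chi> k. x k) =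
    density lborel (\<lambda>y::complex^'n. ennreal (\<Prod>k\<in>UNIV. exp (- (cmod (y $ k))\<^sup>2) / pi))"
proof -
  let ?g = "\<lambda>z::complex. ennreal (exp (- (cmod z)\<^sup>2) / pi)"
  interpret L: product_sigma_finite "\<lambda>_::'n. lborel :: complex measure"
    by (simp add: product_sigma_finite_def lborel.sigma_finite_measure_axioms)
  interpret G: product_sigma_finite "\<lambda>_::'n. complex_gaussian"
    using prob_space_complex_gaussian by (simp add: product_sigma_finite_def prob_space_imp_sigma_finite)
  have comp [measurable]: "(\<lambda>x. x k) \<in> borel_measurable (PiM UNIV (\<lambda>_::'n. lborel :: complex measure))" for k
    using measurable_component_singleton[of k UNIV "\<lambda>_::'n. lborel :: complex measure"] by simp
  have "density (PiM UNIV (\<lambda>_. lborel)) (\<lambda>x. \<Prod>k\<in>UNIV. ?g (x k)) = PiM UNIV (\<lambda>_::'n. complex_gaussian)"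
  proof (rule G.PiM_eqI)
    fix A :: "'n \<Rightarrow> complex set" assume "\<And>k. k \<in> UNIV \<Longrightarrow> A k \<in> sets complex_gaussian"
    then have A [measurable]: "A k \<in> sets borel" for k by simp
    have "emeasure (density (PiM UNIV (\<lambda>_. lborel)) (\<lambda>x. \<Prod>k\<in>UNIV. ?g (x k))) (Pi\<^sub>E UNIV A) =
        (\<integral>\<^sup>+x. (\<Prod>k\<in>UNIV. ?g (x k)) * indicator (Pi\<^sub>E UNIV A) x \<partial>PiM UNIV (\<lambda>_. lborel))"
      using A by (subst emeasure_density) (auto intro!: sets_PiM_I_finite)
    also have "\<dots> = (\<integral>\<^sup>+x. (\<Prod>k\<in>UNIV. ?g (x k) * indicator (A k) (x k)) \<partial>PiM UNIV (\<lambda>_. lborel))"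
    proof (rule nn_integral_cong)
      fix x :: "'n \<Rightarrow> complex"
      have "indicator (Pi\<^sub>E UNIV A) x = (\<Prod>k\<in>UNIV. indicator (A k) (x k) :: ennreal)"
        by (auto simp: indicator_def PiE_iff)
      then show "(\<Prod>k\<in>UNIV. ?g (x k)) * indicator (Pi\<^sub>E UNIV A) x = (\<Prod>k\<in>UNIV. ?g (x k) * indicator (A k) (x k))"
        by (simp add: prod.distrib)
    qed
    also have "\<dots> = (\<Prod>k\<in>UNIV. \<integral>\<^sup>+z. ?g z * indicator (A k) z \<partial>lborel)"
      by (intro L.product_nn_integral_prod) auto
    also have "\<dots> = (\<Prod>k\<in>UNIV. emeasure complex_gaussian (A k))"
      by (simp add: complex_gaussian_def emeasure_density)
    finally show "emeasure (density (PiM UNIV (\<lambda>_. lborel)) (\<lambda>x. \<Prod>k\<in>UNIV. ?g (x k))) (Pi\<^sub>E UNIV A) =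
        (\<Prod>k\<in>UNIV. emeasure complex_gaussian (A k))" .
  qed (auto intro!: sets_PiM_cong)
  then have "distr (PiM UNIV (\<lambda>_. complex_gaussian)) borel (\<lambda>x. (\<chi> k. x k) :: complex^'n) =
      distr (density (PiM UNIV (\<lambda>_. lborel)) (\<lambda>x. \<Prod>k\<in>UNIV. ?g (x k))) borel (\<lambda>x. \<chi> k. x k)"
    by (simp only:)
  also have "\<dots> = density (distr (PiM UNIV (\<lambda>_. lborel)) borel (\<lambda>x. \<chi> k. x k)) (\<lambda>y. \<Prod>k\<in>UNIV. ?g (y $ k))"
    by (subst density_distr) (auto intro!: borel_measurable_vec_lambda comp)
  also have "\<dots> = density lborel (\<lambda>y. \<Prod>k\<in>UNIV. ?g (y $ k))"
    by (simp add: distr_PiM_lborel_vec)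
  also have "(\<lambda>y. \<Prod>k\<in>UNIV. ?g (y $ k)) = (\<lambda>y. ennreal (\<Prod>k\<in>UNIV. exp (- (cmod (y $ k))\<^sup>2) / pi))"
    by (intro ext prod_ennreal) simp
  finally show ?thesis .
qed

text \<open>For fixed p, substituting q \<circ> p for q and reordering the product along p turns the
  inner sum into \<open>det H\<close>, because the sign of p occurs twice. The outer sum then
  consists of n! equal terms.\<close>

lemma sum_sign_permutations_det:
  fixes H :: "'a::{comm_ring_1,semiring_char_0}^'n^'n"
  shows "(\<Sum>p | p permutes UNIV. \<Sum>q | q permutes UNIV. of_int (sign p) * of_int (sign q) * (\<Prod>k\<in>UNIV. H $ p k $ q k)) =
    fact CARD('n) * det H"
proof -
  have "(\<Sum>q | q permutes UNIV. of_int (sign p) * of_int (sign q) * (\<Prod>k\<in>UNIV. H $ p k $ q k)) = det H"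
    if p: "p permutes UNIV" for p :: "'n \<Rightarrow> 'n"
  proof -
    have perm: "permutation p" using p by (simp add: permutation_permutes) blast
    have "(\<Sum>q | q permutes UNIV. of_int (sign p) * of_int (sign q) * (\<Prod>k\<in>UNIV. H $ p k $ q k)) =
        (\<Sum>q | q permutes UNIV. of_int (sign p) * of_int (sign (q \<circ> p)) * (\<Prod>k\<in>UNIV. H $ p k $ (q \<circ> p) k))"
      by (rule sum_permutations_compose_right[OF p])
    also have "\<dots> = (\<Sum>q | q permutes UNIV. of_int (sign q) * (\<Prod>i\<in>UNIV. H $ i $ q i))"
    proof (rule sum.cong)
      fix q :: "'n \<Rightarrow> 'n" assume "q \<in> {q. q permutes UNIV}"
      then have "permutation q" by (simp add: permutation_permutes) blast
      then have "of_int (sign p) * of_int (sign (q \<circ> p)) = (of_int (sign q) :: 'a)"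
        using perm by (simp add: sign_compose) (simp add: sign_def)
      moreover have "(\<Prod>k\<in>UNIV. H $ p k $ (q \<circ> p) k) = (\<Prod>i\<in>UNIV. H $ i $ q i)"
        using prod.permute[OF p, of "\<lambda>i. H $ i $ q i"] by (simp add: o_def)
      ultimately show "of_int (sign p) * of_int (sign (q \<circ> p)) * (\<Prod>k\<in>UNIV. H $ p k $ (q \<circ> p) k) =
          of_int (sign q) * (\<Prod>i\<in>UNIV. H $ i $ q i)" by simp
    qed simp
    finally show ?thesis by (simp add: det_def)
  qed
  then show ?thesis by (simp add: card_permutations)
qed

subsection \<open>Averaging the Jacobian\<close>

lemma bounded_linear_herm: "bounded_linear (herm a)"
  by (rule linear_conv_bounded_linear[THEN iffD1])
     (auto intro!: linearI simp: herm_def distrib_left sum.distrib scaleR_sum_right)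

lemma has_derivative_exp_herm: "((\<lambda>z. exp (herm a z)) has_derivative (\<lambda>h. exp (herm a z) * herm a h)) (at z)"
  using has_derivative_compose[OF bounded_linear_imp_has_derivative[OF bounded_linear_herm, of a]
      DERIV_exp[unfolded has_field_derivative_def]] by simp

lemma has_derivative_vec_lambda:
  fixes f :: "'n::finite \<Rightarrow> 'b::real_normed_vector \<Rightarrow> 'a::euclidean_space"
  assumes "\<And>i. (f i has_derivative f' i) (at x within S)"
  shows "((\<lambda>x. \<chi> i. f i x) has_derivative (\<lambda>h. \<chi> i. f' i h)) (at x within S)"
proof (subst has_derivative_componentwise_within, rule ballI)
  fix b :: "'a^'n" assume "b \<in> Basis"
  then obtain i u where "b = axis i u" by (auto simp: Basis_vec_def)
  then show "((\<lambda>x. (\<chi> i. f i x) \<bullet> b) has_derivative (\<lambda>h. (\<chi> i. f' i h) \<bullet> b)) (at x within S)"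
    using assms[of i] by (simp add: inner_axis has_derivative_inner_left)
qed

section \<open>The system solved for the coefficients of one frequency\<close>

lemma exp_sum_eq_0_iff:
  assumes A: "finite A" "a0 \<in> A"
  shows "exp_sum A c z = 0 \<longleftrightarrow> - (\<Sum>b\<in>A - {a0}. c b * exp (herm (b - a0) z)) = c a0"
proof -
  have h: "exp (herm b z) = exp (herm a0 z) * exp (herm (b - a0) z)" for b
    by (simp add: herm_def exp_add[symmetric] left_diff_distrib sum_subtractf)
  have "exp_sum A c z = c a0 * exp (herm a0 z) + (\<Sum>b\<in>A - {a0}. c b * exp (herm b z))"
    unfolding exp_sum_def using A by (rule sum.remove)
  also have "(\<Sum>b\<in>A - {a0}. c b * exp (herm b z)) = exp (herm a0 z) * (\<Sum>b\<in>A - {a0}. c b * exp (herm (b - a0) z))"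
    unfolding sum_distrib_left by (intro sum.cong refl) (subst h, simp add: mult.left_commute)
  finally have "exp_sum A c z = exp (herm a0 z) * (c a0 + (\<Sum>b\<in>A - {a0}. c b * exp (herm (b - a0) z)))"
    by (simp add: distrib_left mult.commute)
  then show ?thesis by (simp add: neg_eq_iff_add_eq_0 add.commute)
qed

text \<open>Once the coefficients \<open>\<eta> (k, b)\<close> with \<open>b \<noteq> a0\<close> are chosen, \<open>z\<close> is a zero of the system iff the
  remaining coefficients are the coordinates of \<open>solved_coeff (A - {a0}) a0 \<eta> z\<close>.\<close>

definition solved_coeff ::
    "(complex^'n) set \<Rightarrow> complex^'n \<Rightarrow> ('n \<times> (complex^'n) \<Rightarrow> complex) \<Rightarrow> complex^'n \<Rightarrow> complex^'n" where
  "solved_coeff B a0 \<eta> z = (\<chi> k. - (\<Sum>b\<in>B. \<eta> (k, b) * exp (herm (b - a0) z)))"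

definition solved_coeff_deriv ::
    "(complex^'n) set \<Rightarrow> complex^'n \<Rightarrow> ('n \<times> (complex^'n) \<Rightarrow> complex) \<Rightarrow> complex^'n \<Rightarrow> complex^'n^'n" where
  "solved_coeff_deriv B a0 \<eta> z = (\<chi> k j. - (\<Sum>b\<in>B. \<eta> (k, b) * (exp (herm (b - a0) z) * cnj ((b - a0) $ j))))"

lemma has_derivative_solved_coeff:
  "(solved_coeff B a0 \<eta> has_derivative (*v) (solved_coeff_deriv B a0 \<eta> z)) (at z)"
proof -
  have eq: "(*v) (solved_coeff_deriv B a0 \<eta> z) =
      (\<lambda>h. \<chi> k. - (\<Sum>b\<in>B. \<eta> (k, b) * (exp (herm (b - a0) z) * herm (b - a0) h)))"
    (is "?L = ?R")
  proof
    fix h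
    have "(\<Sum>j\<in>UNIV. (\<Sum>b\<in>B. \<eta> (k, b) * (exp (herm (b - a0) z) * cnj ((b - a0) $ j))) * h $ j) =
        (\<Sum>b\<in>B. \<eta> (k, b) * (exp (herm (b - a0) z) * herm (b - a0) h))" for k
      unfolding herm_def sum_distrib_left sum_distrib_right
      by (subst sum.swap) (simp add: mult.assoc)
    then show "?L h = ?R h"
      by (simp add: vec_eq_iff matrix_vector_mult_def solved_coeff_deriv_def sum_negf)
  qed
  have "((\<lambda>z. \<chi> k. - (\<Sum>b\<in>B. \<eta> (k, b) * exp (herm (b - a0) z))) has_derivative
      (\<lambda>h. \<chi> k. - (\<Sum>b\<in>B. \<eta> (k, b) * (exp (herm (b - a0) z) * herm (b - a0) h)))) (at z)"
    by (intro has_derivative_vec_lambda has_derivative_minus has_derivative_sum has_derivative_mult_right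
        has_derivative_exp_herm)
  then show ?thesis unfolding eq by (simp add: solved_coeff_def[abs_def])
qed

lemma continuous_on_herm [continuous_intros]: "continuous_on S f \<Longrightarrow> continuous_on S (\<lambda>z. herm a (f z))"
  unfolding herm_def by (intro continuous_intros)

lemma continuous_on_solved_coeff: "continuous_on S (solved_coeff B a0 \<eta>)"
  unfolding solved_coeff_def[abs_def] by (intro continuous_intros)

lemma continuous_on_solved_coeff_deriv: "continuous_on S (solved_coeff_deriv B a0 \<eta>)"
  unfolding solved_coeff_deriv_def[abs_def] by (intro continuous_intros)

text \<open>The sesquilinear extension of \<open>integral_PiM_gaussian_cov\<close>. In the
  application \<open>w\<close> holds the coefficients of one coordinate of the solved system, and
  \<open>v\<close> and \<open>u\<close> hold those of two of its partial derivatives.\<close>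

lemma integral_PiM_gaussian_bilinear:
  fixes w v u :: "'i \<Rightarrow> complex"
  assumes I: "finite I"
  defines "S \<equiv> 1 + (\<Sum>p\<in>I. (cmod (w p))\<^sup>2)"
  shows "has_bochner_integral (PiM I (\<lambda>_. complex_gaussian))
    (\<lambda>x. exp (- (cmod (\<Sum>p\<in>I. w p * x p))\<^sup>2) *\<^sub>R ((\<Sum>p\<in>I. v p * x p) * cnj (\<Sum>q\<in>I. u q * x q)))
    (((\<Sum>p\<in>I. v p * cnj (u p)) - (\<Sum>p\<in>I. v p * cnj (w p)) * (\<Sum>q\<in>I. w q * cnj (u q)) / S) / S)"
proof -
  let ?e = "\<lambda>x. exp (- (cmod (\<Sum>p\<in>I. w p * x p))\<^sup>2)"
  note measurable_component_complex_gaussian [measurable]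
  have "has_bochner_integral (PiM I (\<lambda>_. complex_gaussian)) (\<lambda>x. ?e x *\<^sub>R (x p * cnj (x q)))
      (((if p = q then 1 else 0) - cnj (w p) * w q / S) / S)" if "p \<in> I" "q \<in> I" for p q
    unfolding has_bochner_integral_iff S_def
    using I that integral_PiM_gaussian_cov[OF I that, of w]
    by (intro conjI integrable_PiM_gaussian_product) auto
  then have "has_bochner_integral (PiM I (\<lambda>_. complex_gaussian))
      (\<lambda>x. \<Sum>p\<in>I. \<Sum>q\<in>I. (v p * cnj (u q)) * (?e x *\<^sub>R (x p * cnj (x q))))
      (\<Sum>p\<in>I. \<Sum>q\<in>I. (v p * cnj (u q)) * (((if p = q then 1 else 0) - cnj (w p) * w q / S) / S))"
    by (intro has_bochner_integral_sum has_bochner_integral_mult_right)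
  moreover have "(\<lambda>x. \<Sum>p\<in>I. \<Sum>q\<in>I. (v p * cnj (u q)) * (?e x *\<^sub>R (x p * cnj (x q)))) =
      (\<lambda>x. ?e x *\<^sub>R ((\<Sum>p\<in>I. v p * x p) * cnj (\<Sum>q\<in>I. u q * x q)))"
    unfolding cnj_sum sum_product scaleR_sum_right
    by (intro ext sum.cong refl) (simp add: scaleR_conv_of_real mult_ac)
  moreover have "(\<Sum>p\<in>I. \<Sum>q\<in>I. (v p * cnj (u q)) * (((if p = q then 1 else 0) - cnj (w p) * w q / S) / S)) =
      ((\<Sum>p\<in>I. v p * cnj (u p)) - (\<Sum>p\<in>I. v p * cnj (w p)) * (\<Sum>q\<in>I. w q * cnj (u q)) / S) / S"
  proof -
    have "(v p * cnj (u q)) * (((if p = q then 1 else 0) - cnj (w p) * w q / S) / S) =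
        ((if p = q then v p * cnj (u p) else 0) - (v p * cnj (w p)) * (w q * cnj (u q)) / S) / S" for p q
      by (simp add: field_simps)
    then show ?thesis
      using I by (simp only: sum_divide_distrib[symmetric] sum_subtractf sum_product) (simp cong: if_cong)
  qed
  ultimately show ?thesis by simp
qed

text \<open>Translation invariance of a covariance. It removes the shift of all frequencies by
  \<open>a0\<close> that the division by exp (a0, z) has introduced.\<close>

lemma covariance_shift:
  fixes p x y :: "'b \<Rightarrow> 'a::comm_ring_1"
  assumes "sum p A = 1"
  shows "(\<Sum>a\<in>A. p a * ((x a - c) * (y a - d))) - (\<Sum>a\<in>A. p a * (x a - c)) * (\<Sum>a\<in>A. p a * (y a - d)) =
    (\<Sum>a\<in>A. p a * (x a * y a)) - (\<Sum>a\<in>A. p a * x a) * (\<Sum>a\<in>A. p a * y a)"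
proof -
  have 1: "(\<Sum>a\<in>A. p a * (f a - e)) = (\<Sum>a\<in>A. p a * f a) - e" for f e
    using assms by (simp add: right_diff_distrib sum_subtractf sum_distrib_right[symmetric])
  have "p a * ((x a - c) * (y a - d)) = p a * (x a * y a) - c * (p a * y a) - d * (p a * x a) + c * d * p a" for a
    by (simp add: algebra_simps)
  then have "(\<Sum>a\<in>A. p a * ((x a - c) * (y a - d))) =
      (\<Sum>a\<in>A. p a * (x a * y a)) - c * (\<Sum>a\<in>A. p a * y a) - d * (\<Sum>a\<in>A. p a * x a) + c * d * sum p A"
    by (simp add: sum.distrib sum_subtractf sum_distrib_left)
  then show ?thesis unfolding 1 using assms by (simp add: algebra_simps)
qed

text \<open>This brings the Gibbs covariance into the form that the Gaussian average produces. The
  numbers |w b|^2 / S are the Gibbs weights, the 1 in \<open>S\<close> is the term of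
  \<open>a0\<close>, and the sums over \<open>B\<close> extend to \<open>A\<close> because b - a0
  vanishes at b = a0.\<close>

lemma complex_hessian_Phi_shift:
  fixes A :: "(complex^'n) set" and z :: "complex^'n"
  assumes A: "finite A" "a0 \<in> A"
  defines "B \<equiv> A - {a0}" and "w \<equiv> \<lambda>b. exp (herm (b - a0) z)"
  defines "S \<equiv> 1 + (\<Sum>b\<in>B. (cmod (w b))\<^sup>2)"
  shows "complex_hessian (Phi A) z $ i $ j =
    ((\<Sum>b\<in>B. (w b * cnj ((b - a0) $ i)) * cnj (w b * cnj ((b - a0) $ j))) -
      (\<Sum>b\<in>B. (w b * cnj ((b - a0) $ i)) * cnj (w b)) * (\<Sum>b\<in>B. w b * cnj (w b * cnj ((b - a0) $ j))) / S) / S"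
proof -
  have ne: "A \<noteq> {}" using A by auto
  let ?E = "exp (2 * Re (herm a0 z))" and ?p = "\<lambda>a. complex_of_real (gibbs A z a)"
  have S: "S > 0" by (simp add: S_def add_pos_nonneg sum_nonneg)
  have e: "exp (2 * Re (herm b z)) = ?E * (cmod (w b))\<^sup>2" for b
  proof -
    have "herm (b - a0) z = herm b z - herm a0 z" by (simp add: herm_def left_diff_distrib sum_subtractf)
    then show ?thesis
      by (simp add: w_def norm_exp_eq_Re exp_double[symmetric] mult_exp_exp)
  qed
  have w0: "w a0 = 1" by (simp add: w_def herm_def)
  have "(\<Sum>b\<in>A. (cmod (w b))\<^sup>2) = S"
    unfolding S_def B_def using sum.remove[OF A, of "\<lambda>b. (cmod (w b))\<^sup>2"] by (simp add: w0)
  then have "(\<Sum>b\<in>A. exp (2 * Re (herm b z))) = ?E * S"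
    using sum.cong[OF refl[of A], OF e] by (simp only: sum_distrib_left[symmetric])
  then have g: "gibbs A z b = (cmod (w b))\<^sup>2 / S" for b
    using e[of b] by (simp add: gibbs_def)
  have ww: "w b * cnj (w b) = of_real S * ?p b" for b
    using S complex_norm_square[of "w b"] by (simp add: g)
  have B: "(\<Sum>b\<in>B. f b) = (\<Sum>a\<in>A. f a)" if "f a0 = 0" for f :: "complex^'n \<Rightarrow> complex"
    using sum.remove[OF A, of f] that by (simp add: B_def)
  have red: "(\<Sum>b\<in>B. f b) = of_real S * (\<Sum>a\<in>A. ?p a * g a)"
    if "\<And>b. f b = (w b * cnj (w b)) * g b" "g a0 = 0" for f g :: "complex^'n \<Rightarrow> complex"
  proof -
    have "(\<Sum>b\<in>B. f b) = (\<Sum>a\<in>A. f a)" by (rule B) (simp only: that mult_zero_right)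
    also have "\<dots> = of_real S * (\<Sum>a\<in>A. ?p a * g a)"
      by (simp only: that(1) ww sum_distrib_left mult.assoc)
    finally show ?thesis .
  qed
  have 1: "(\<Sum>b\<in>B. (w b * cnj ((b - a0) $ i)) * cnj (w b * cnj ((b - a0) $ j))) =
      of_real S * (\<Sum>a\<in>A. ?p a * ((cnj (a $ i) - cnj (a0 $ i)) * (a $ j - a0 $ j)))"
    by (rule red) (simp_all add: mult_ac)
  have 2: "(\<Sum>b\<in>B. (w b * cnj ((b - a0) $ i)) * cnj (w b)) = of_real S * (\<Sum>a\<in>A. ?p a * (cnj (a $ i) - cnj (a0 $ i)))"
    by (rule red) (simp_all add: mult_ac)
  have 3: "(\<Sum>b\<in>B. w b * cnj (w b * cnj ((b - a0) $ j))) = of_real S * (\<Sum>a\<in>A. ?p a * (a $ j - a0 $ j))"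
    by (rule red) (simp_all add: mult_ac)
  have p1: "sum ?p A = 1" using sum_gibbs[OF A(1) ne, of z] by (metis of_real_1 of_real_sum)
  have "((s * P - (s * Q) * (s * R) / s) / s) = P - Q * R" if "s \<noteq> 0" for s P Q R :: complex
    using that by (simp add: field_simps)
  then show ?thesis
    unfolding 1 2 3 complex_hessian_Phi[OF A(1) ne]
    using S covariance_shift[OF p1, of "\<lambda>a. cnj (a $ i)" "cnj (a0 $ i)" "\<lambda>a. a $ j" "a0 $ j"] by simp
qed

lemma sum_singleton_Times: "(\<Sum>p\<in>{k} \<times> B. f p) = (\<Sum>b\<in>B. f (k, b))"
  using sum.cartesian_product[of "\<lambda>k b. f (k, b)" B "{k}"] by simp

text \<open>The factor that row \<open>k\<close> contributes to the weighted expansion of det times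
  its conjugate, \<open>i\<close> and \<open>j\<close> being the columns chosen by the two
  permutations. It reads only coefficients with first index \<open>k\<close>, so different rows give
  independent factors.\<close>

definition row_weight ::
    "(complex^'n) set \<Rightarrow> complex^'n \<Rightarrow> complex^'n \<Rightarrow> 'n \<Rightarrow> 'n \<Rightarrow> 'n \<Rightarrow> ('n \<times> (complex^'n) \<Rightarrow> complex) \<Rightarrow> complex" where
  "row_weight B a0 z k i j \<eta> = exp (- (cmod (solved_coeff B a0 \<eta> z $ k))\<^sup>2) *\<^sub>R
     (solved_coeff_deriv B a0 \<eta> z $ k $ i * cnj (solved_coeff_deriv B a0 \<eta> z $ k $ j))"

lemma row_weight_eq:
  "row_weight B a0 z k i j \<eta> = exp (- (cmod (\<Sum>p\<in>{k} \<times> B. exp (herm (snd p - a0) z) * \<eta> p))\<^sup>2) *\<^sub>R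
    ((\<Sum>p\<in>{k} \<times> B. (exp (herm (snd p - a0) z) * cnj ((snd p - a0) $ i)) * \<eta> p) *
      cnj (\<Sum>p\<in>{k} \<times> B. (exp (herm (snd p - a0) z) * cnj ((snd p - a0) $ j)) * \<eta> p))"
proof -
  have "(\<Sum>p\<in>{k} \<times> B. f p) = (\<Sum>b\<in>B. f (k, b))" for f :: "_ \<Rightarrow> complex"
    by (rule sum_singleton_Times)
  then show ?thesis
    by (simp add: row_weight_def solved_coeff_def solved_coeff_deriv_def mult.commute)
qed

lemma row_weight_restrict:
  "row_weight B a0 z k i j (restrict \<eta> ({k} \<times> B)) = row_weight B a0 z k i j \<eta>"
  unfolding row_weight_eq by (simp cong: sum.cong)

lemma measurable_row_weight:
  assumes "finite B"
  shows "row_weight B a0 z k i j \<in> borel_measurable (PiM ({k} \<times> B) (\<lambda>_. borel))"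
proof -
  have [measurable]: "(\<lambda>x. x p) \<in> borel_measurable (PiM ({k} \<times> B) (\<lambda>_. borel))" if "p \<in> {k} \<times> B" for p
    using that by (rule measurable_component_singleton)
  show ?thesis
    unfolding row_weight_eq[abs_def] by measurable
qed

text \<open>The value does not depend on \<open>k\<close>, since all rows have the same law; this is
  why a single matrix enters the final determinant.\<close>

lemma (in prob_space) expectation_row_weight:
  fixes A :: "(complex^'n) set" and X :: "'n \<times> (complex^'n) \<Rightarrow> 'a \<Rightarrow> complex"
  assumes A: "finite A" "a0 \<in> A"
    and ind: "indep_vars (\<lambda>_. borel) X (UNIV \<times> A)"
    and X: "\<And>p. p \<in> UNIV \<times> A \<Longrightarrow> distr M borel (X p) = complex_gaussian"
  shows "has_bochner_integral M (\<lambda>\<omega>. row_weight (A - {a0}) a0 z k i j (\<lambda>p. X p \<omega>)) (complex_hessian (Phi A) z $ i $ j)"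
proof -
  let ?B = "A - {a0}"
  let ?I = "{k} \<times> ?B"
  let ?r = "\<lambda>\<omega>. \<lambda>p\<in>?I. X p \<omega>"
  have I: "finite ?I" "?I \<subseteq> UNIV \<times> A" using A by auto
  have rv: "X p \<in> borel_measurable M" if "p \<in> UNIV \<times> A" for p
    using ind that by (auto simp: indep_vars_def)
  have meas: "?r \<in> M \<rightarrow>\<^sub>M PiM ?I (\<lambda>_. borel)"
    using rv I by (intro measurable_restrict) auto
  have d: "distr M (PiM ?I (\<lambda>_. borel)) ?r = PiM ?I (\<lambda>_. complex_gaussian)"
    using X I by (intro distr_restrict_complex_gaussian indep_vars_subset[OF ind]) auto
  let ?w = "\<lambda>b. exp (herm (b - a0) z)"
  let ?S = "1 + (\<Sum>p\<in>?I. (cmod (?w (snd p)))\<^sup>2)"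
  let ?H = "((\<Sum>p\<in>?I. (?w (snd p) * cnj ((snd p - a0) $ i)) * cnj (?w (snd p) * cnj ((snd p - a0) $ j))) -
      (\<Sum>p\<in>?I. (?w (snd p) * cnj ((snd p - a0) $ i)) * cnj (?w (snd p))) *
      (\<Sum>p\<in>?I. ?w (snd p) * cnj (?w (snd p) * cnj ((snd p - a0) $ j))) / ?S) / ?S"
  have "has_bochner_integral (distr M (PiM ?I (\<lambda>_. borel)) ?r) (row_weight ?B a0 z k i j) ?H"
    unfolding d row_weight_eq[abs_def] by (rule integral_PiM_gaussian_bilinear[OF I(1)])
  moreover have "?H = complex_hessian (Phi A) z $ i $ j"
    unfolding complex_hessian_Phi_shift[OF A] sum_singleton_Times snd_conv by (rule refl)
  ultimately have "has_bochner_integral M (\<lambda>\<omega>. row_weight ?B a0 z k i j (?r \<omega>)) (complex_hessian (Phi A) z $ i $ j)"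
    using measurable_row_weight[of ?B] A meas
    by (simp add: has_bochner_integral_iff integrable_distr_eq integral_distr)
  then show ?thesis by (simp only: row_weight_restrict)
qed

lemma (in prob_space) expectation_det_solved_coeff:
  fixes A :: "(complex^'n) set" and X :: "'n \<times> (complex^'n) \<Rightarrow> 'a \<Rightarrow> complex"
  assumes A: "finite A" "a0 \<in> A"
    and ind: "indep_vars (\<lambda>_. borel) X (UNIV \<times> A)"
    and X: "\<And>p. p \<in> UNIV \<times> A \<Longrightarrow> distr M borel (X p) = complex_gaussian"
  shows "has_bochner_integral M
    (\<lambda>\<omega>. (\<Prod>k\<in>UNIV. exp (- (cmod (solved_coeff (A - {a0}) a0 (\<lambda>p. X p \<omega>) z $ k))\<^sup>2)) *
       (cmod (det (solved_coeff_deriv (A - {a0}) a0 (\<lambda>p. X p \<omega>) z)))\<^sup>2)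
    (fact CARD('n) * Re (det (complex_hessian (Phi A) z)))"
proof -
  let ?B = "A - {a0}" and ?H = "complex_hessian (Phi A) z"
  let ?P = "{p. p permutes (UNIV :: 'n set)}"
  let ?J = "\<lambda>\<omega>. solved_coeff_deriv ?B a0 (\<lambda>p. X p \<omega>) z"
  let ?e = "\<lambda>k \<omega>. exp (- (cmod (solved_coeff ?B a0 (\<lambda>p. X p \<omega>) z $ k))\<^sup>2)"
  let ?Y = "\<lambda>k i j \<omega>. row_weight ?B a0 z k i j (\<lambda>p. X p \<omega>)"
  have row: "has_bochner_integral M (?Y k i j) (?H $ i $ j)" for k i j
    by (rule expectation_row_weight[OF A ind X])
  \<comment> \<open>For a fixed pair of permutations the rows use disjoint blocks of an independent
    family, so the expectation of the product over rows factors.\<close>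
  have "has_bochner_integral M (\<lambda>\<omega>. \<Prod>k\<in>UNIV. ?Y k (p k) (q k) \<omega>) (\<Prod>k\<in>UNIV. ?H $ p k $ q k)" for p q
  proof -
    have "indep_vars (\<lambda>k. PiM ({k} \<times> ?B) (\<lambda>_. borel)) (\<lambda>k \<omega>. restrict (\<lambda>p. X p \<omega>) ({k} \<times> ?B)) UNIV"
      by (rule indep_vars_restrict[OF ind]) (auto simp: disjoint_family_on_def)
    then have "indep_vars (\<lambda>_. borel) (\<lambda>k \<omega>. row_weight ?B a0 z k (p k) (q k) (restrict (\<lambda>p. X p \<omega>) ({k} \<times> ?B))) UNIV"
      by (rule indep_vars_compose2[where Y = "\<lambda>k. row_weight ?B a0 z k (p k) (q k)"])
         (use A in \<open>simp add: measurable_row_weight\<close>)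
    then have ind': "indep_vars (\<lambda>_. borel) (\<lambda>k. ?Y k (p k) (q k)) UNIV"
      by (simp only: row_weight_restrict)
    show ?thesis
      using row indep_vars_lebesgue_integral[OF _ ind'] indep_vars_integrable[OF _ ind']
      by (simp add: has_bochner_integral_iff)
  qed
  then have "has_bochner_integral M
      (\<lambda>\<omega>. \<Sum>p\<in>?P. \<Sum>q\<in>?P. of_int (sign p) * of_int (sign q) * (\<Prod>k\<in>UNIV. ?Y k (p k) (q k) \<omega>))
      (\<Sum>p\<in>?P. \<Sum>q\<in>?P. of_int (sign p) * of_int (sign q) * (\<Prod>k\<in>UNIV. ?H $ p k $ q k))"
    by (intro has_bochner_integral_sum has_bochner_integral_mult_right)
  moreover have "(\<Sum>p\<in>?P. \<Sum>q\<in>?P. of_int (sign p) * of_int (sign q) * (\<Prod>k\<in>UNIV. ?Y k (p k) (q k) \<omega>)) =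
      complex_of_real ((\<Prod>k\<in>UNIV. ?e k \<omega>) * (cmod (det (?J \<omega>)))\<^sup>2)" for \<omega>
  proof -
    have "complex_of_real ((\<Prod>k\<in>UNIV. ?e k \<omega>) * (cmod (det (?J \<omega>)))\<^sup>2) =
        (\<Prod>k\<in>UNIV. of_real (?e k \<omega>)) * (det (?J \<omega>) * cnj (det (?J \<omega>)))"
      by (simp only: of_real_mult of_real_prod complex_norm_square)
    also have "\<dots> = (\<Sum>p\<in>?P. \<Sum>q\<in>?P. (\<Prod>k\<in>UNIV. of_real (?e k \<omega>)) *
        ((of_int (sign p) * (\<Prod>k\<in>UNIV. ?J \<omega> $ k $ p k)) * (of_int (sign q) * (\<Prod>k\<in>UNIV. cnj (?J \<omega> $ k $ q k)))))"
      unfolding det_def cnj_sum sum_product unfolding sum_distrib_left by simp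
    also have "\<dots> = (\<Sum>p\<in>?P. \<Sum>q\<in>?P. of_int (sign p) * of_int (sign q) * (\<Prod>k\<in>UNIV. ?Y k (p k) (q k) \<omega>))"
      by (intro sum.cong refl) (simp add: row_weight_def scaleR_conv_of_real prod.distrib mult_ac)
    finally show ?thesis by simp
  qed
  ultimately have "has_bochner_integral M (\<lambda>\<omega>. complex_of_real ((\<Prod>k\<in>UNIV. ?e k \<omega>) * (cmod (det (?J \<omega>)))\<^sup>2))
      (fact CARD('n) * det ?H)"
    by (simp only: sum_sign_permutations_det)
  \<comment> \<open>The averaging is done over the complex numbers, where det and its conjugate
    expand separately. The averaged quantity is real, so taking real parts is harmless.\<close>
  from has_bochner_integral_bounded_linear[OF bounded_linear_Re this]
  have "has_bochner_integral M (\<lambda>\<omega>. (\<Prod>k\<in>UNIV. ?e k \<omega>) * (cmod (det (?J \<omega>)))\<^sup>2) (Re (fact CARD('n) * det ?H))"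
    by (simp only: Re_complex_of_real)
  also have "Re (fact CARD('n) * det ?H) = fact CARD('n) * Re (det ?H)"
    by (subst of_real_fact[symmetric]) (simp del: of_real_fact)
  finally show ?thesis .
qed

section \<open>Measurability in the coefficients and in the point\<close>

lemma solved_coeff_restrict:
  "solved_coeff B a0 (restrict \<eta> (UNIV \<times> B)) = solved_coeff B a0 \<eta>"
  "solved_coeff_deriv B a0 (restrict \<eta> (UNIV \<times> B)) = solved_coeff_deriv B a0 \<eta>"
  by (simp_all add: fun_eq_iff solved_coeff_def solved_coeff_deriv_def cong: sum.cong)

lemma borel_measurable_herm [measurable (raw)]:
  assumes "f \<in> borel_measurable M"
  shows "(\<lambda>x. herm a (f x)) \<in> borel_measurable M"
  using assms by (rule measurable_compose) (intro borel_measurable_continuous_onI continuous_intros)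

lemma borel_measurable_det:
  fixes J :: "'w \<Rightarrow> complex^'n^'n"
  assumes "\<And>i j. (\<lambda>x. J x $ i $ j) \<in> borel_measurable M"
  shows "(\<lambda>x. det (J x)) \<in> borel_measurable M"
  unfolding det_def using assms by measurable

lemma borel_measurable_solved_coeff:
  assumes "\<And>k b. b \<in> B \<Longrightarrow> (\<lambda>x. \<eta> x (k, b)) \<in> borel_measurable M" and [measurable]: "f \<in> borel_measurable M"
  shows "(\<lambda>x. solved_coeff B a0 (\<eta> x) (f x)) \<in> borel_measurable M"
    and "(\<lambda>x. det (solved_coeff_deriv B a0 (\<eta> x) (f x))) \<in> borel_measurable M"
proof -
  show "(\<lambda>x. solved_coeff B a0 (\<eta> x) (f x)) \<in> borel_measurable M"
    unfolding solved_coeff_def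
    by (intro borel_measurable_vec_lambda borel_measurable_uminus borel_measurable_sum borel_measurable_times assms)
       measurable
  show "(\<lambda>x. det (solved_coeff_deriv B a0 (\<eta> x) (f x))) \<in> borel_measurable M"
    unfolding solved_coeff_deriv_def
    by (intro borel_measurable_det, unfold vec_lambda_beta)
       (intro borel_measurable_uminus borel_measurable_sum borel_measurable_times assms, measurable)
qed

lemma borel_measurable_complex_hessian_Phi:
  assumes "finite A" "A \<noteq> {}"
  shows "(\<lambda>z. Re (det (complex_hessian (Phi A) z))) \<in> borel_measurable borel"
proof -
  have [measurable]: "(\<lambda>z. gibbs A z a) \<in> borel_measurable borel" for a
    unfolding gibbs_def by measurable
  have "(\<lambda>z. det (complex_hessian (Phi A) z)) \<in> borel_measurable borel"
    by (intro borel_measurable_det) (unfold complex_hessian_Phi[OF assms], measurable)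
  then show ?thesis by measurable
qed

section \<open>Law of the isolated coefficients, and conditioning on the others\<close>

definition gaussian_density_vec :: "complex^'n \<Rightarrow> real" where
  "gaussian_density_vec y = (\<Prod>k\<in>UNIV. exp (- (cmod (y $ k))\<^sup>2) / pi)"

lemma gaussian_density_vec_nonneg: "gaussian_density_vec y \<ge> 0"
  by (simp add: gaussian_density_vec_def prod_nonneg)

lemma borel_measurable_gaussian_density_vec [measurable]: "gaussian_density_vec \<in> borel_measurable borel"
  unfolding gaussian_density_vec_def[abs_def] by measurable

text \<open>As the density of the law of a random vector it has total mass 1.\<close>

lemma integrable_gaussian_density_vec: "integrable lborel (gaussian_density_vec :: complex^'n \<Rightarrow> real)"
proof (rule integrableI_nonneg)
  have [measurable]: "(\<lambda>x. \<chi> k. x k) \<in> borel_measurable (PiM UNIV (\<lambda>_::'n. complex_gaussian))"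
    by (intro borel_measurable_vec_lambda measurable_component_complex_gaussian) simp
  have "prob_space (distr (PiM UNIV (\<lambda>_. complex_gaussian)) borel (\<lambda>x. \<chi> (k::'n). x k))"
    by (intro prob_space.prob_space_distr prob_space_PiM prob_space_complex_gaussian) measurable
  then have "emeasure (density lborel (\<lambda>y::complex^'n. ennreal (gaussian_density_vec y))) UNIV = 1"
    unfolding distr_PiM_complex_gaussian_vec gaussian_density_vec_def[symmetric]
    using prob_space.emeasure_space_1 by fastforce
  then show "(\<integral>\<^sup>+y. ennreal (gaussian_density_vec (y :: complex^'n)) \<partial>lborel) < \<infinity>"
    by (simp add: emeasure_density)
qed (simp_all add: gaussian_density_vec_nonneg)

lemma (in prob_space) distr_vec_complex_gaussian:
  fixes Y :: "'n::finite \<Rightarrow> 'a \<Rightarrow> complex"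
  assumes ind: "indep_vars (\<lambda>_. borel) Y UNIV"
    and Y: "\<And>k. distr M borel (Y k) = complex_gaussian"
  shows "distr M borel (\<lambda>\<omega>. \<chi> k. Y k \<omega>) = density lborel (\<lambda>y. ennreal (gaussian_density_vec y))"
proof -
  have [measurable]: "Y k \<in> borel_measurable M" for k
    using ind by (auto simp: indep_vars_def)
  have m1: "(\<lambda>\<omega>. \<lambda>k\<in>UNIV. Y k \<omega>) \<in> M \<rightarrow>\<^sub>M PiM UNIV (\<lambda>_. borel)"
    by (intro measurable_restrict) measurable
  have m2: "(\<lambda>x. \<chi> k. x k) \<in> borel_measurable (PiM UNIV (\<lambda>_::'n. borel :: complex measure))"
    by (intro borel_measurable_vec_lambda measurable_component_singleton) simp
  have "distr M borel (\<lambda>\<omega>. \<chi> k. Y k \<omega>) =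
      distr (distr M (PiM UNIV (\<lambda>_. borel)) (\<lambda>\<omega>. \<lambda>k\<in>UNIV. Y k \<omega>)) borel (\<lambda>x. \<chi> k. x k)"
    by (subst distr_distr[OF m2 m1]) (simp add: comp_def restrict_UNIV)
  also have "distr M (PiM UNIV (\<lambda>_. borel)) (\<lambda>\<omega>. \<lambda>k\<in>UNIV. Y k \<omega>) = PiM UNIV (\<lambda>_. complex_gaussian)"
    by (intro distr_restrict_complex_gaussian ind Y) simp
  finally show ?thesis by (simp only: distr_PiM_complex_gaussian_vec gaussian_density_vec_def)
qed

lemma borel_measurable_count_solved_coeff:
  assumes "open U"
    and "\<And>k b. b \<in> B \<Longrightarrow> (\<lambda>x. \<eta> x (k, b)) \<in> borel_measurable M" and [measurable]: "y \<in> borel_measurable M"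
  shows "(\<lambda>x. emeasure (count_space UNIV) {z \<in> U. solved_coeff B a0 (\<eta> x) z = y x}) \<in> borel_measurable M"
proof -
  have [measurable]: "(\<lambda>x. solved_coeff B a0 (\<eta> x) z) \<in> borel_measurable M" for z
    using assms(2) by (rule borel_measurable_solved_coeff) simp_all
  have "(\<lambda>x. emeasure (count_space UNIV) {z \<in> U. solved_coeff B a0 (\<eta> x) z - y x = 0}) \<in> borel_measurable M"
    by (intro borel_measurable_count_zeros[OF assms(1)] continuous_intros continuous_on_solved_coeff) measurable
  then show ?thesis by simp
qed

text \<open>By independence the joint law is a product, so \<open>X\<close> can be frozen while
  \<open>h (Y \<omega>)\<close> is integrated against its density. The map \<open>h\<close> is kept
  apart because independence is available for whole families of coefficients, whereas the density
  belongs to the vector formed from them.\<close>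

lemma (in prob_space) nn_integral_indep_var_density:
  assumes ind: "indep_var P X Q Y" and [measurable]: "h \<in> borel_measurable Q"
    and h: "distr M borel (\<lambda>\<omega>. h (Y \<omega>)) = density lborel \<phi>"
    and [measurable]: "\<phi> \<in> borel_measurable borel" "F \<in> borel_measurable (P \<Otimes>\<^sub>M borel)"
  shows "(\<integral>\<^sup>+\<omega>. F (X \<omega>, h (Y \<omega>)) \<partial>M) = (\<integral>\<^sup>+\<omega>. (\<integral>\<^sup>+y. \<phi> y * F (X \<omega>, y) \<partial>lborel) \<partial>M)"
proof -
  have [measurable]: "X \<in> M \<rightarrow>\<^sub>M P" "Y \<in> M \<rightarrow>\<^sub>M Q"
    using ind by (auto dest: indep_var_rv1 indep_var_rv2)
  interpret Y: prob_space "distr M Q Y" by (rule prob_space_distr) measurable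
  have "(\<integral>\<^sup>+\<omega>. F (X \<omega>, h (Y \<omega>)) \<partial>M) =
      (\<integral>\<^sup>+p. F (fst p, h (snd p)) \<partial>distr M (P \<Otimes>\<^sub>M Q) (\<lambda>\<omega>. (X \<omega>, Y \<omega>)))"
    by (simp add: nn_integral_distr)
  also have "\<dots> = (\<integral>\<^sup>+p. F (fst p, h (snd p)) \<partial>(distr M P X \<Otimes>\<^sub>M distr M Q Y))"
    using ind by (simp add: indep_var_distribution_eq)
  also have "\<dots> = (\<integral>\<^sup>+x. (\<integral>\<^sup>+y. F (x, h y) \<partial>distr M Q Y) \<partial>distr M P X)"
    by (subst Y.nn_integral_fst[symmetric]) simp_all
  also have "\<dots> = (\<integral>\<^sup>+\<omega>. (\<integral>\<^sup>+y. F (X \<omega>, h y) \<partial>distr M Q Y) \<partial>M)"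
    by (subst nn_integral_distr) (auto intro!: Y.borel_measurable_nn_integral)
  also have "\<dots> = (\<integral>\<^sup>+\<omega>. (\<integral>\<^sup>+y. \<phi> y * F (X \<omega>, y) \<partial>lborel) \<partial>M)"
  proof (rule nn_integral_cong)
    fix \<omega> assume [simp]: "\<omega> \<in> space M"
    have [simp]: "X \<omega> \<in> space P" by (rule measurable_space[of X M]) simp_all
    have [measurable]: "(\<lambda>y. F (X \<omega>, y)) \<in> borel_measurable borel" by simp
    have "(\<integral>\<^sup>+y. F (X \<omega>, h y) \<partial>distr M Q Y) = (\<integral>\<^sup>+y. F (X \<omega>, y) \<partial>distr M borel (\<lambda>\<omega>. h (Y \<omega>)))"
      by (simp add: nn_integral_distr)
    also have "\<dots> = (\<integral>\<^sup>+y. \<phi> y * F (X \<omega>, y) \<partial>lborel)"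
      unfolding h by (simp add: nn_integral_density)
    finally show "(\<integral>\<^sup>+y. F (X \<omega>, h y) \<partial>distr M Q Y) = (\<integral>\<^sup>+y. \<phi> y * F (X \<omega>, y) \<partial>lborel)" .
  qed
  finally show ?thesis .
qed

theorem theorem6:
  fixes M :: "'w measure"
    and A U :: "(complex ^ 'n) set"
    and \<xi> :: "'n \<Rightarrow> complex ^ 'n \<Rightarrow> 'w \<Rightarrow> complex"
  assumes "prob_space M"
    and "finite A" and "A \<noteq> {}"
    and "\<And>k a. a \<in> A \<Longrightarrow> std_complex_gaussian M (\<xi> k a)"
    and "prob_space.indep_vars M (\<lambda>_. borel) (\<lambda>(k, a). \<xi> k a) (UNIV \<times> A)"
    and "open U"
  shows "expected_zeros M (\<lambda>k \<omega>. exp_sum A (\<lambda>a. \<xi> k a \<omega>)) U =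
    ennreal (fact CARD('n) / pi ^ CARD('n)) *
      (\<integral>\<^sup>+ z \<in> U. ennreal (Re (det (complex_hessian (Phi A) z))) \<partial>lborel)"
proof -
  interpret prob_space M by fact
  obtain a0 where a0: "a0 \<in> A" using \<open>A \<noteq> {}\<close> by auto
  define B where "B = A - {a0}"
  define X where "X = (\<lambda>(k, a). \<xi> k a)"
  have X: "X p \<in> borel_measurable M" "distr M borel (X p) = complex_gaussian" if "p \<in> UNIV \<times> A" for p
    using that assms(1,4) by (auto simp: X_def distr_std_complex_gaussian)
  have ind: "indep_vars (\<lambda>_. borel) X (UNIV \<times> A)" using assms(5) by (simp add: X_def)
  let ?P = "PiM (UNIV \<times> B) (\<lambda>_. borel :: complex measure)"
  \<comment> \<open>Restriction to \<open>UNIV \<times> B\<close> makes \<eta> a random element of a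
    product space that involves none of the coefficients of \<open>a0\<close>;
    \<open>solved_coeff B\<close> reads only these entries.\<close>
  define \<eta> where "\<eta> = (\<lambda>\<omega>. \<lambda>p\<in>UNIV \<times> B. X p \<omega>)"
  define \<zeta> where "\<zeta> = (\<lambda>\<omega>. \<chi> k. X (k, a0) \<omega>)"
  let ?\<phi> = "gaussian_density_vec :: complex^'n \<Rightarrow> real"
  let ?N = "\<lambda>(x, y). emeasure (count_space UNIV) {z \<in> U. solved_coeff B a0 x z = y}"
  let ?g = "\<lambda>\<omega>. solved_coeff B a0 (\<lambda>p. X p \<omega>)" and ?J = "\<lambda>\<omega>. solved_coeff_deriv B a0 (\<lambda>p. X p \<omega>)"
  let ?F = "\<lambda>\<omega> z. ennreal (?\<phi> (?g \<omega> z) * (cmod (det (?J \<omega> z)))\<^sup>2) * indicator U z"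
  have N: "?N \<in> borel_measurable (?P \<Otimes>\<^sub>M borel)"
    unfolding split_beta'
  proof (rule borel_measurable_count_solved_coeff[OF \<open>open U\<close>])
    fix k b assume "b \<in> B"
    then show "(\<lambda>p. fst p (k, b)) \<in> borel_measurable (?P \<Otimes>\<^sub>M borel)"
      by (intro measurable_compose[OF measurable_fst] measurable_component_singleton) auto
  qed simp
  let ?r = "\<lambda>\<omega>. \<lambda>p\<in>UNIV \<times> {a0}. X p \<omega>"
  have indep: "indep_var ?P \<eta> (PiM (UNIV \<times> {a0}) (\<lambda>_. borel)) ?r"
    unfolding \<eta>_def using a0 by (intro indep_var_restrict[OF ind]) (auto simp: B_def)
  have h: "(\<lambda>x. \<chi> k. x (k, a0)) \<in> borel_measurable (PiM (UNIV \<times> {a0}) (\<lambda>_. borel :: complex measure))"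
    by (intro borel_measurable_vec_lambda measurable_component_singleton) simp
  have \<zeta>r: "\<zeta> = (\<lambda>\<omega>. \<chi> k. ?r \<omega> (k, a0))" by (simp add: \<zeta>_def)
  have \<zeta>: "distr M borel \<zeta> = density lborel (\<lambda>y. ennreal (?\<phi> y))"
    unfolding \<zeta>_def
  proof (rule distr_vec_complex_gaussian)
    have "indep_vars (\<lambda>k. PiM {(k, a0)} (\<lambda>_. borel)) (\<lambda>k \<omega>. restrict (\<lambda>p. X p \<omega>) {(k, a0)}) UNIV"
      using a0 by (intro indep_vars_restrict[OF ind]) (auto simp: disjoint_family_on_def)
    from indep_vars_compose2[OF this, where Y = "\<lambda>k x. x (k, a0)" and N = "\<lambda>_. borel"]
    show "indep_vars (\<lambda>_. borel) (\<lambda>k. X (k, a0)) UNIV"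
      by (simp add: measurable_component_singleton)
  qed (use X a0 in auto)
  have zeros: "{z \<in> U. \<forall>k. exp_sum A (\<lambda>a. \<xi> k a \<omega>) z = 0} = {z \<in> U. solved_coeff B a0 (\<eta> \<omega>) z = \<zeta> \<omega>}" for \<omega>
    unfolding exp_sum_eq_0_iff[OF \<open>finite A\<close> a0] \<eta>_def solved_coeff_restrict
    by (simp add: \<zeta>_def X_def solved_coeff_def vec_eq_iff B_def)
  have "expected_zeros M (\<lambda>k \<omega>. exp_sum A (\<lambda>a. \<xi> k a \<omega>)) U = (\<integral>\<^sup>+\<omega>. ?N (\<eta> \<omega>, \<zeta> \<omega>) \<partial>M)"
    by (simp add: expected_zeros_def zeros)
  also have "\<dots> = (\<integral>\<^sup>+\<omega>. (\<integral>\<^sup>+y. ennreal (?\<phi> y) * ?N (\<eta> \<omega>, y) \<partial>lborel) \<partial>M)"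
    unfolding \<zeta>r by (rule nn_integral_indep_var_density[OF indep h \<zeta>[unfolded \<zeta>r] _ N]) measurable
  also have "\<dots> = (\<integral>\<^sup>+\<omega>. (\<integral>\<^sup>+z. ?F \<omega> z \<partial>lborel) \<partial>M)"
  proof (rule nn_integral_cong)
    fix \<omega>
    have "(\<lambda>y. emeasure (count_space UNIV) {z \<in> U. ?g \<omega> z = y}) \<in> borel_measurable borel"
      by (rule borel_measurable_count_solved_coeff[OF \<open>open U\<close>]) simp_all
    then show "(\<integral>\<^sup>+y. ennreal (?\<phi> y) * ?N (\<eta> \<omega>, y) \<partial>lborel) = (\<integral>\<^sup>+z. ?F \<omega> z \<partial>lborel)"
      unfolding prod.case \<eta>_def solved_coeff_restrict
      by (rule complex_area_formula[OF \<open>open U\<close> has_derivative_solved_coeff continuous_on_solved_coeff_deriv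
            continuous_on_solved_coeff gaussian_density_vec_nonneg integrable_gaussian_density_vec])
  qed
  also have "\<dots> = (\<integral>\<^sup>+z. (\<integral>\<^sup>+\<omega>. ?F \<omega> z \<partial>M) \<partial>lborel)"
  proof -
    interpret pair_sigma_finite M lborel
      by (intro pair_sigma_finite.intro sigma_finite_measure_axioms lborel.sigma_finite_measure_axioms)
    have *: "(\<lambda>p. X (k, b) (fst p)) \<in> borel_measurable (M \<Otimes>\<^sub>M lborel)" if "b \<in> B" for k b
      using that by (intro measurable_compose[OF measurable_fst X(1)]) (auto simp: B_def)
    have snd: "snd \<in> borel_measurable (M \<Otimes>\<^sub>M (lborel :: (complex^'n) measure))"
      using measurable_snd[of M "lborel :: (complex^'n) measure"] by simp
    have [measurable]: "(\<lambda>p. ?g (fst p) (snd p)) \<in> borel_measurable (M \<Otimes>\<^sub>M lborel)"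
      "(\<lambda>p. det (?J (fst p) (snd p))) \<in> borel_measurable (M \<Otimes>\<^sub>M lborel)"
      using * by (auto intro!: borel_measurable_solved_coeff[where \<eta> = "\<lambda>p q. X q (fst p)", OF _ snd])
    have [measurable]: "U \<in> sets borel" using \<open>open U\<close> by simp
    show ?thesis
      by (rule Fubini'[symmetric]) (simp add: split_beta')
  qed
  also have "\<dots> = (\<integral>\<^sup>+z. ennreal (fact CARD('n) / pi ^ CARD('n)) * (ennreal (Re (det (complex_hessian (Phi A) z))) * indicator U z) \<partial>lborel)"
  proof (rule nn_integral_cong)
    fix z
    let ?R = "\<lambda>\<omega>. (\<Prod>k\<in>UNIV. exp (- (cmod (?g \<omega> z $ k))\<^sup>2)) * (cmod (det (?J \<omega> z)))\<^sup>2"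
    have R: "has_bochner_integral M ?R (fact CARD('n) * Re (det (complex_hessian (Phi A) z)))"
      unfolding B_def using X(2) by (rule expectation_det_solved_coeff[OF \<open>finite A\<close> a0 ind])
    \<comment> \<open>The row weights are not normalised; division by \<pi>^n turns their product
      into the density of \<zeta> at the value of the solved system.\<close>
    have "has_bochner_integral M (\<lambda>\<omega>. ?R \<omega> / pi ^ CARD('n)) (fact CARD('n) * Re (det (complex_hessian (Phi A) z)) / pi ^ CARD('n))"
      using R by (rule has_bochner_integral_divide_zero)
    moreover have "?R \<omega> / pi ^ CARD('n) = ?\<phi> (?g \<omega> z) * (cmod (det (?J \<omega> z)))\<^sup>2" for \<omega>
      by (simp add: gaussian_density_vec_def prod_dividef)
    ultimately have "(\<integral>\<^sup>+\<omega>. ennreal (?\<phi> (?g \<omega> z) * (cmod (det (?J \<omega> z)))\<^sup>2) \<partial>M) =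
        ennreal (fact CARD('n) * Re (det (complex_hessian (Phi A) z)) / pi ^ CARD('n))"
      by (subst nn_integral_eq_integral) (auto simp: has_bochner_integral_iff gaussian_density_vec_nonneg)
    then show "(\<integral>\<^sup>+\<omega>. ?F \<omega> z \<partial>M) =
        ennreal (fact CARD('n) / pi ^ CARD('n)) * (ennreal (Re (det (complex_hessian (Phi A) z))) * indicator U z)"
      by (cases "z \<in> U") (simp_all add: ennreal_mult'[symmetric])
  qed
  also have "\<dots> = ennreal (fact CARD('n) / pi ^ CARD('n)) *
      (\<integral>\<^sup>+ z \<in> U. ennreal (Re (det (complex_hessian (Phi A) z))) \<partial>lborel)"
  proof (rule nn_integral_cmult)
    have [measurable]: "U \<in> sets borel" using \<open>open U\<close> by simp
    note borel_measurable_complex_hessian_Phi[OF \<open>finite A\<close> \<open>A \<noteq> {}\<close>, measurable]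
    show "(\<lambda>z. ennreal (Re (det (complex_hessian (Phi A) z))) * indicator U z) \<in> borel_measurable lborel"
      by measurable
  qed
  finally show ?thesis .
qed

end
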